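(* Let $m>n\geq 1$, let $\Lambda\subset\mathbb R^n$ be a Delone, Bohr almost periodic set of toral type, with associated toral compactification $(\mathbb T^m,\psi)$ of $\mathbb R^n$, $\psi=\rho_m\circ M$, where $M\in\mathbb R^{m\times n}$ satisfies $M^TM=I_n$. Let $K:=\overline{\psi(\Lambda)}\subset\mathbb T^m$, let $V:=M\mathbb R^n\subset\mathbb R^m$, and let $U$ be the orthogonal complement of $V$ in $\mathbb R^m$. Let $K_c$ be a connected component of $K$ and let $H_c$ be a connected component of $\rho_m^{-1}(K_c)$. Then there exists a continuous map $h_1:U\rightarrow V$ such that the map $u\mapsto h_1(u)+u$ is a homeomorphism of $U$ onto $H_c$.
   Context: Notation. $\mathbb T=\{z\in\mathbb C:|z|=1\}$. $\rho_m:\mathbb R^m\to\mathbb T^m$ is $\rho_m([x_1,\dots,x_m]^T)=[e^{2\pi i x_1},\dots,e^{2\pi i x_m}]^T$. For $y\in\mathbb R^n$, $\chi_y(x)=e^{2\pi i y^Tx}$. $U(\mathbb R^n)$ (Bohr almost periodic functions) is the sup-norm closure of $\mathrm{span}\{\chi_y:y\in\mathbb R^n\}$ in the bounded continuous functions $\mathbb R^n\to\mathbb C$. $B(x,R)$ is the open ball and $V_n(R)$ is the volume of $B(0,R)\subset\mathbb R^n$. Delone: $\Lambda\subset\mathbb R^n$ is Delone if $R_1(\Lambda):=\inf\{\|\lambda_2-\lambda_1\|:\lambda_1\ne\lambda_2\in\Lambda\}>0$ and there is a finite $R$ with $\bigcup_{\lambda\in\Lambda}B(\lambda,R)=\mathbb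 R^n$. Bohr almost periodic: with $\mu:=\sum_{\lambda\in\Lambda}\delta_\lambda$ and $(\mu*f)(x)=\sum_{\lambda\in\Lambda}f(x-\lambda)$, $\Lambda$ is Bohr almost periodic if $\mu*f\in U(\mathbb R^n)$ for every $f\in C_c(\mathbb R^n)$. Toral type: for such $\Lambda$ the spectrum $\Omega(\mu)$ is the set of $y\in\mathbb R^n$ for which $\widehat\mu(y):=\lim_{R\to\infty}V_n(R)^{-1}\sum_{\lambda\in\Lambda\cap B(0,R)}\chi_{-y}(\lambda)\neq 0$. $\Lambda$ is of toral type if $\Omega(\mu)$ generates a subgroup of $\mathbb R^n$ of finite rank $m$. Toral compactification: a pair $(\mathbb T^m,\psi)$ with $\psi:\mathbb R^n\to\mathbb T^m$ a continuous homomorphism with dense image; then $\psi=\rho_m\circ M$ for a matrix $M\in\mathbb R^{m\times n}$ whose rows are linearly independent over $\mathbb Q$. It is associated with $\Lambda$ if $\Omega(\mu)\subset M^T\mathbb Z^m$; equivalently (for Bohr almost periodic $\Lambda$), for each $f\in C_c(\mathbb R^n)$ there is a continuous $\Theta f:\mathbb T^m\to\mathbb C$ with $(\Theta f)\circ\psi=\mu*f$. *)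

theory Defs
  imports "HOL-Analysis.Analysis"
begin

definition torus :: "(complex ^ 'm::finite) set" where
  "torus = {z. \<forall>i. cmod (z $ i) = 1}"

definition rho :: "real ^ 'm \<Rightarrow> complex ^ 'm::finite" where
  "rho x = (\<chi> i. exp (2 * of_real pi * \<i> * of_real (x $ i)))"

definition character :: "real ^ 'n \<Rightarrow> real ^ 'n::finite \<Rightarrow> complex" where
  "character y x = exp (2 * of_real pi * \<i> * of_real (y \<bullet> x))"

text \<open>The complex span of the characters, inside the bounded continuous functions; the
  library's \<open>span\<close> on this type is the real one.\<close>

definition trig_polynomials :: "((real ^ 'n::finite) \<Rightarrow>\<^sub>C complex) set" where
  "trig_polynomials =
     {p. \<exists>F c. finite F \<and> (\<forall>x. apply_bcontfun p x = (\<Sum>y\<in>F. c y * character y x))}"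

text \<open>The metric on the type of bounded continuous functions is the supremum metric.\<close>

definition bohr_ap_functions :: "(real ^ 'n::finite \<Rightarrow> complex) set" where
  "bohr_ap_functions = apply_bcontfun ` closure trig_polynomials"

definition Cc :: "(real ^ 'n::finite \<Rightarrow> complex) set" where
  "Cc = {f. continuous_on UNIV f \<and> compact (closure {x. f x \<noteq> 0})}"

text \<open>\<open>Inf\<close> is unspecified for the empty set of reals; this is harmless in \<open>delone\<close>, where the
  covering condition forces the set to be infinite.\<close>

definition R1 :: "(real ^ 'n::finite) set \<Rightarrow> real" where
  "R1 \<Lambda> = Inf {norm (b - a) | a b. a \<in> \<Lambda> \<and> b \<in> \<Lambda> \<and> a \<noteq> b}"

definition delone :: "(real ^ 'n::finite) set \<Rightarrow> bool" where
  "delone \<Lambda> \<longleftrightarrow> R1 \<Lambda> > 0 \<and> (\<exists>R::real. (\<Union>l\<in>\<Lambda>. ball l R) = UNIV)"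

text \<open>The convolution of the sum of Dirac measures on \<open>\<Lambda>\<close> with \<open>f\<close>. For \<open>\<Lambda>\<close> Delone and
  \<open>f \<in> Cc\<close> only finitely many terms are nonzero.\<close>

definition mu_conv :: "(real ^ 'n::finite) set \<Rightarrow> (real ^ 'n \<Rightarrow> complex) \<Rightarrow> real ^ 'n \<Rightarrow> complex" where
  "mu_conv \<Lambda> f x = (\<Sum>\<^sub>\<infinity>l\<in>\<Lambda>. f (x - l))"

definition bohr_ap_set :: "(real ^ 'n::finite) set \<Rightarrow> bool" where
  "bohr_ap_set \<Lambda> \<longleftrightarrow> (\<forall>f\<in>Cc. mu_conv \<Lambda> f \<in> bohr_ap_functions)"

definition has_mu_hat :: "(real ^ 'n::finite) set \<Rightarrow> real ^ 'n \<Rightarrow> complex \<Rightarrow> bool" where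
  "has_mu_hat \<Lambda> y c \<longleftrightarrow>
     ((\<lambda>R::real. (\<Sum>l\<in>\<Lambda> \<inter> ball 0 R. character (- y) l)
          / of_real (measure lebesgue (ball (0::real ^ 'n) R))) \<longlongrightarrow> c) at_top"

definition spectrum :: "(real ^ 'n::finite) set \<Rightarrow> (real ^ 'n) set" where
  "spectrum \<Lambda> = {y. \<exists>c. has_mu_hat \<Lambda> y c \<and> c \<noteq> 0}"

text \<open>Real vector spaces as modules over the integers: submodules are additive subgroups,
  \<open>module.span int_scale S\<close> is the subgroup generated by \<open>S\<close>, and \<open>module.independent int_scale\<close>
  is linear independence over the integers.\<close>

definition int_scale :: "int \<Rightarrow> 'a::real_vector \<Rightarrow> 'a" where
  "int_scale k x = of_int k *\<^sub>R x"

lemma module_int_scale: "module int_scale"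
  by unfold_locales (simp_all add: int_scale_def algebra_simps)

definition has_rank :: "'a::real_vector set \<Rightarrow> nat \<Rightarrow> bool" where
  "has_rank G r \<longleftrightarrow>
     (\<exists>B\<subseteq>G. module.independent int_scale B \<and> finite B \<and> card B = r) \<and>
     (\<forall>B\<subseteq>G. module.independent int_scale B \<longrightarrow> finite B \<and> card B \<le> r)"

definition toral_type :: "(real ^ 'n::finite) set \<Rightarrow> bool" where
  "toral_type \<Lambda> \<longleftrightarrow> (\<exists>r. has_rank (module.span int_scale (spectrum \<Lambda>)) r)"

text \<open>The product on \<^typ>\<open>complex ^ 'm\<close> is componentwise, hence restricts to the group operation
  of the torus.\<close>

definition toral_compactification :: "(real ^ 'n::finite \<Rightarrow> complex ^ 'm::finite) \<Rightarrow> bool" where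
  "toral_compactification \<psi> \<longleftrightarrow>
     range \<psi> \<subseteq> torus \<and> continuous_on UNIV \<psi> \<and>
     (\<forall>x y. \<psi> (x + y) = \<psi> x * \<psi> y) \<and> closure (range \<psi>) = torus"

text \<open>Association of the compactification \<open>rho \<circ> (\<lambda>x. M *v x)\<close> with \<open>\<Lambda>\<close>.\<close>

definition associated :: "(real ^ 'n::finite) set \<Rightarrow> real ^ 'n ^ 'm::finite \<Rightarrow> bool" where
  "associated \<Lambda> M \<longleftrightarrow> spectrum \<Lambda> \<subseteq> {transpose M *v k | k. \<forall>i. k $ i \<in> \<int>}"

end

theory Submission
  imports Defs
begin

text \<open>
  Let \<open>f\<close> be continuous with compact support. The Fourier coefficient of \<open>\<mu> * f\<close> at \<open>y\<close> is the Fourier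
  transform of \<open>f\<close> at \<open>y\<close> times the \<open>y\<close>-density of \<open>\<Lambda>\<close>, so the frequencies of \<open>\<mu> * f\<close> lie in
  the spectrum and hence in \<open>M\<^sup>T \<int>\<^sup>m\<close>. Bohr's approximation theorem then makes \<open>\<mu> * f\<close> uniformly
  continuous for the pseudometric pulled back along \<open>\<psi>\<close>. Testing this with tent functions \<open>f\<close> of
  small support shows that two points of \<open>K\<close> on one orbit of the flow \<open>q \<mapsto> q \<psi>(t)\<close> differ by a time of
  length at least \<open>R\<^sub>1(\<Lambda>)\<close>, and that every point of the torus close to \<open>K\<close> is moved into \<open>K\<close> by a short
  time. Lifted to \<open>\<real>\<^sup>m\<close>, these two facts say that the orthogonal projection of the preimage of \<open>K\<close> onto \<open>U\<close>
  is a covering map. As \<open>U\<close> is simply connected, there are continuous sections, and the image of a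
  section is open and closed in the preimage of \<open>K\<close>, hence a component.
\<close>

subsection \<open>Mean values over balls\<close>

definition ball_mean :: "('a::euclidean_space \<Rightarrow> complex) \<Rightarrow> real \<Rightarrow> complex" where
  "ball_mean g R = (LINT x:ball 0 R|lborel. g x) / of_real (measure lborel (ball (0::'a) R))"

text \<open>Only balls centred at the origin enter, matching the averages in
  \<open>has_mu_hat\<close>.\<close>

definition has_mean :: "('a::euclidean_space \<Rightarrow> complex) \<Rightarrow> complex \<Rightarrow> bool" where
  "has_mean g c \<longleftrightarrow> (ball_mean g \<longlongrightarrow> c) at_top"

lemma measure_ball_pos: "R > 0 \<Longrightarrow> measure lborel (ball (c::'a::euclidean_space) R) > 0"
  by (simp add: content_ball)

lemma set_integrable_ball_continuous:
  fixes g :: "'a::euclidean_space \<Rightarrow> 'b::{banach,second_countable_topology}"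
  assumes "continuous_on UNIV g"
  shows "set_integrable lborel (ball c R) g"
proof (rule set_integrable_subset)
  show "set_integrable lborel (cball c R) g"
    unfolding set_integrable_def
    by (intro borel_integrable_compact continuous_on_subset[OF assms]) auto
qed auto

lemma has_mean_add:
  assumes "continuous_on UNIV f" "continuous_on UNIV g" "has_mean f a" "has_mean g b"
  shows "has_mean (\<lambda>x. f x + g x) (a + b)"
proof -
  have "ball_mean (\<lambda>x. f x + g x) = (\<lambda>R. ball_mean f R + ball_mean g R)"
    using assms
    by (auto simp: ball_mean_def set_integral_add set_integrable_ball_continuous add_divide_distrib)
  then show ?thesis using assms by (auto simp: has_mean_def intro: tendsto_add)
qed

lemma has_mean_cmult:
  assumes "has_mean g b"
  shows "has_mean (\<lambda>x. a * g x) (a * b)"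
proof -
  have "ball_mean (\<lambda>x. a * g x) = (\<lambda>R. a * ball_mean g R)"
    by (auto simp: ball_mean_def)
  then show ?thesis using assms by (auto simp: has_mean_def intro: tendsto_mult_left)
qed

lemma has_mean_diff:
  assumes "continuous_on UNIV f" "continuous_on UNIV g" "has_mean f a" "has_mean g b"
  shows "has_mean (\<lambda>x. f x - g x) (a - b)"
  using has_mean_add[OF assms(1) _ assms(3) has_mean_cmult[OF assms(4), of "-1"]] assms(2)
  by (simp add: continuous_on_minus)

lemma has_mean_const: "has_mean (\<lambda>_::'a::euclidean_space. c) c"
proof -
  have "ball_mean (\<lambda>_::'a. c) R = c" if "R > 0" for R
  proof -
    have "(LINT x:ball (0::'a) R|lborel. c) = measure lborel (ball (0::'a) R) *\<^sub>R c"
      by (subst set_integral_const) (use emeasure_lborel_ball_finite[of "0::'a" R] in auto)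
    then show ?thesis
      using measure_ball_pos[OF that, of "0::'a"] by (simp add: ball_mean_def scaleR_conv_of_real)
  qed
  then have "\<forall>\<^sub>F R in at_top. ball_mean (\<lambda>_::'a. c) R = c"
    using eventually_gt_at_top[of "0::real"] by (rule eventually_mono[rotated])
  then show ?thesis
    unfolding has_mean_def by (rule tendsto_eventually)
qed

lemma has_mean_sum:
  assumes "finite I" "\<And>i. i \<in> I \<Longrightarrow> continuous_on UNIV (f i)" "\<And>i. i \<in> I \<Longrightarrow> has_mean (f i) (a i)"
  shows "has_mean (\<lambda>x. \<Sum>i\<in>I. f i x) (\<Sum>i\<in>I. a i)"
  using assms
proof (induction I rule: finite_induct)
  case empty
  then show ?case using has_mean_const[of 0] by simp
next
  case (insert i I)
  then show ?case by (auto intro!: has_mean_add continuous_on_sum)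
qed

lemma has_mean_unique: "has_mean g a \<Longrightarrow> has_mean g b \<Longrightarrow> a = b"
  unfolding has_mean_def using tendsto_unique trivial_limit_at_top_linorder by blast

lemma norm_ball_mean_le:
  fixes g :: "'a::euclidean_space \<Rightarrow> complex" and h :: "'a \<Rightarrow> real"
  assumes "continuous_on UNIV g" "continuous_on UNIV h" "\<And>x. cmod (g x) \<le> h x"
  shows "cmod (ball_mean g R) \<le> cmod (ball_mean (\<lambda>x. of_real (h x)) R)"
proof -
  let ?B = "ball (0::'a) R"
  have ig: "set_integrable lborel ?B g"
    using assms set_integrable_ball_continuous by blast
  have h0: "h x \<ge> 0" for x using assms(3)[of x] norm_ge_zero order_trans by blast
  have ih: "set_integrable lborel ?B h"
    using assms set_integrable_ball_continuous by blast
  have "cmod (LINT x:?B|lborel. g x) \<le> (LINT x:?B|lborel. cmod (g x))"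
    using set_integral_norm_bound[OF ig] .
  also have "\<dots> \<le> (LINT x:?B|lborel. h x)"
    using ih set_integrable_norm[OF ig] assms(3) by (intro set_integral_mono) auto
  also have "\<dots> \<le> cmod (of_real (LINT x:?B|lborel. h x))" by simp
  also have "of_real (LINT x:?B|lborel. h x) = (LINT x:?B|lborel. complex_of_real (h x))"
    by (simp add: set_integral_complex_of_real)
  finally show ?thesis
    by (simp add: ball_mean_def norm_divide divide_right_mono)
qed

text \<open>The limit form of \<open>norm_ball_mean_le\<close>. With \<open>h\<close> a reflected
  translate of a nonnegative kernel of mean one, it expresses that convolution with the kernel does
  not increase the supremum norm.\<close>

lemma norm_mean_le:
  assumes "continuous_on UNIV g" "continuous_on UNIV h" "\<And>x. cmod (g x) \<le> e * h x"
    "has_mean g c" "has_mean (\<lambda>x. complex_of_real (h x)) 1" "e \<ge> 0"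
  shows "cmod c \<le> e"
proof -
  have "has_mean (\<lambda>x. complex_of_real (e * h x)) (of_real e * 1)"
    unfolding of_real_mult using has_mean_cmult assms(5) by blast
  then have "((\<lambda>R. cmod (ball_mean (\<lambda>x. of_real (e * h x)) R)) \<longlongrightarrow> cmod (of_real e * 1)) at_top"
    "((\<lambda>R. cmod (ball_mean g R)) \<longlongrightarrow> cmod c) at_top"
    using assms(4) unfolding has_mean_def by (blast intro: tendsto_norm)+
  from tendsto_le[OF _ this] have "cmod c \<le> cmod (of_real e * 1)"
    using norm_ball_mean_le[OF assms(1) _ assms(3)] assms(2)
    by (simp add: continuous_on_mult_left eventually_mono)
  then show ?thesis using assms(6) by simp
qed

text \<open>Averaging does not increase the supremum norm, so an approximant with a mean confines
  the averages of \<open>g\<close> over large balls to a small disc. The averages therefore form a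
  Cauchy filter, which converges by completeness.\<close>

lemma mean_exists_uniform_limit:
  fixes g :: "'a::euclidean_space \<Rightarrow> complex"
  assumes g: "continuous_on UNIV g"
    and approx: "\<And>e. e > 0 \<Longrightarrow> \<exists>h c. continuous_on UNIV h \<and> has_mean h c \<and> (\<forall>x. cmod (g x - h x) \<le> e)"
  shows "\<exists>c. has_mean g c"
proof -
  have close: "\<exists>c. \<forall>\<^sub>F R in at_top. cmod (ball_mean g R - c) < e" if e: "e > 0" for e
  proof -
    obtain h c where h: "continuous_on UNIV h" "has_mean h c" "\<And>x. cmod (g x - h x) \<le> e/3"
      using approx[of "e/3"] e by auto
    have d: "cmod (ball_mean g R - ball_mean h R) \<le> cmod (ball_mean (\<lambda>_::'a. of_real (e/3)) R)" for R
    proof -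
      have "ball_mean g R - ball_mean h R = ball_mean (\<lambda>x. g x - h x) R"
        using g h by (simp add: ball_mean_def set_integral_diff set_integrable_ball_continuous diff_divide_distrib)
      then show ?thesis
        using norm_ball_mean_le[of "\<lambda>x. g x - h x" "\<lambda>_. e/3"] g h by (simp add: continuous_on_diff)
    qed
    \<comment> \<open>The average of a constant is that constant only for positive radii, so it is
      treated as a limit as well; \<open>e/3 + e/9 + e/3\<close> is still below
      \<open>e\<close>.\<close>
    have "\<forall>\<^sub>F R in at_top. dist (ball_mean (\<lambda>_::'a. of_real (e/3)) R) (of_real (e/3)) < e/9"
      using has_mean_const[where 'a='a, of "of_real (e/3)"] e
      unfolding has_mean_def by (intro tendstoD) auto
    moreover have "\<forall>\<^sub>F R in at_top. dist (ball_mean h R) c < e/3"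
      using h(2) e unfolding has_mean_def by (intro tendstoD) auto
    ultimately have "\<forall>\<^sub>F R in at_top. cmod (ball_mean g R - c) < e"
    proof eventually_elim
      case (elim R)
      have "cmod (ball_mean (\<lambda>_::'a. of_real (e/3)) R) \<le> e/3 + e/9"
        using norm_triangle_sub[of "ball_mean (\<lambda>_::'a. of_real (e/3)) R" "of_real (e/3)"] elim(1) e
        by (simp add: dist_norm)
      moreover have "cmod (ball_mean g R - c)
          \<le> cmod (ball_mean g R - ball_mean h R) + cmod (ball_mean h R - c)"
        using norm_triangle_ineq[of "ball_mean g R - ball_mean h R" "ball_mean h R - c"] by simp
      ultimately show ?case using d[of R] elim(2) e by (simp add: dist_norm)
    qed
    then show ?thesis by blast
  qed
  have "cauchy_filter (filtermap (ball_mean g) at_top)"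
    unfolding cauchy_filter_metric_filtermap
  proof (intro allI impI)
    fix e :: real assume "e > 0"
    then obtain c where c: "\<forall>\<^sub>F R in at_top. cmod (ball_mean g R - c) < e/2"
      using close[of "e/2"] by auto
    show "\<exists>P. eventually P at_top \<and> (\<forall>x y. P x \<and> P y \<longrightarrow> dist (ball_mean g x) (ball_mean g y) < e)"
      by (intro exI[of _ "\<lambda>R. cmod (ball_mean g R - c) < e/2"] conjI c)
         (auto simp: dist_norm[symmetric] intro: dist_triangle_half_l)
  qed
  then obtain c where "filtermap (ball_mean g) at_top \<le> nhds c"
    using complete_UNIV[where 'a=complex] unfolding complete_uniform
    by (metis UNIV_I filtermap_bot_iff top_greatest top_eq_principal_UNIV trivial_limit_at_top_linorder)
  then show ?thesis
    unfolding has_mean_def filterlim_def by blast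
qed

section \<open>Volumes of thin annuli\<close>

lemma annulus_volume_ratio:
  "((\<lambda>R. (measure lborel (ball (0::'a::euclidean_space) (R + d)) - measure lborel (ball (0::'a) (R - d)))
      / measure lborel (ball (0::'a) R)) \<longlongrightarrow> 0) at_top"
proof -
  let ?n = "DIM('a)"
  \<comment> \<open>Ball volumes are proportional to \<open>R ^ ?n\<close>, so the ratio is a
    difference of two powers that both tend to one.\<close>
  have "((\<lambda>R. (1 + d / R) ^ ?n - (1 - d / R) ^ ?n) \<longlongrightarrow> (1 + 0) ^ ?n - (1 - 0) ^ ?n) at_top"
    by (intro tendsto_intros tendsto_divide_0[OF tendsto_const] filterlim_at_top_imp_at_infinity filterlim_ident)
  moreover have "(1 + d / R) ^ ?n - (1 - d / R) ^ ?n =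
      (measure lborel (ball (0::'a) (R + d)) - measure lborel (ball (0::'a) (R - d))) / measure lborel (ball (0::'a) R)"
    if "R > \<bar>d\<bar>" for R
  proof -
    have R: "R > 0" using that by linarith
    have p: "unit_ball_vol (real ?n) \<noteq> 0"
      using unit_ball_vol_pos[of "real ?n"] by linarith
    have "(1 + d / R) ^ ?n = (R + d) ^ ?n / R ^ ?n" "(1 - d / R) ^ ?n = (R - d) ^ ?n / R ^ ?n"
      using R by (simp_all add: add_divide_distrib diff_divide_distrib flip: power_divide)
    then show ?thesis
      using that R p by (simp add: content_ball diff_divide_distrib)
  qed
  then have "\<forall>\<^sub>F R in at_top. (1 + d / R) ^ ?n - (1 - d / R) ^ ?n =
      (measure lborel (ball (0::'a) (R + d)) - measure lborel (ball (0::'a) (R - d))) / measure lborel (ball (0::'a) R)"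
    using eventually_gt_at_top[of "\<bar>d\<bar>"] by (rule eventually_mono[rotated])
  ultimately show ?thesis by (simp add: tendsto_cong)
qed

text \<open>The region of boundary effects: a translation or a support of size \<open>d\<close>
  disturbs integrals over \<open>ball 0 R\<close> only here. For \<open>R \<le> d\<close> the inner
  ball is empty.\<close>

definition annulus :: "real \<Rightarrow> real \<Rightarrow> 'a::euclidean_space set" where
  "annulus R d = ball 0 (R + d) - ball 0 (R - d)"

lemma annulus_fmeasurable [simp]: "(annulus R d :: 'a::euclidean_space set) \<in> fmeasurable lborel"
  unfolding annulus_def by (rule fmeasurable_Diff) (use emeasure_lborel_ball_finite[of "0::'a" "R + d"] in \<open>auto simp: fmeasurable_def\<close>)

lemma measure_annulus:
  assumes "d \<ge> 0"
  shows "measure lborel (annulus R d :: 'a::euclidean_space set)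
    = measure lborel (ball (0::'a) (R + d)) - measure lborel (ball (0::'a) (R - d))"
  unfolding annulus_def
proof (rule measure_Diff)
  show "emeasure lborel (ball (0::'a) (R + d)) \<noteq> \<infinity>"
    using emeasure_lborel_ball_finite[of "0::'a" "R + d"] by simp
  show "ball (0::'a) (R - d) \<subseteq> ball 0 (R + d)" using assms by (intro subset_ball) simp
qed auto

lemma annulus_ratio_tendsto:
  assumes "d \<ge> 0"
  shows "((\<lambda>R. measure lborel (annulus R d :: 'a::euclidean_space set) / measure lborel (ball (0::'a) R)) \<longlongrightarrow> 0) at_top"
  using annulus_volume_ratio[where 'a='a] assms by (simp add: measure_annulus)

lemma integral_lborel_translate:
  fixes f :: "'a::euclidean_space \<Rightarrow> 'b::{banach,second_countable_topology}"
  assumes "f \<in> borel_measurable borel"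
  shows "(\<integral>x. f (t + x) \<partial>lborel) = (\<integral>x. f x \<partial>lborel)"
proof -
  have "(\<integral>x. f x \<partial>lborel) = (\<integral>x. f x \<partial>(distr lborel borel ((+) t)))"
    by (simp add: lborel_distr_plus)
  also have "\<dots> = (\<integral>x. f (t + x) \<partial>lborel)"
    by (rule integral_distr) (use assms in auto)
  finally show ?thesis by simp
qed

section \<open>Characters and their means\<close>

lemma continuous_on_character [continuous_intros]:
  assumes "continuous_on A f"
  shows "continuous_on A (\<lambda>x. character y (f x))"
  unfolding character_def by (intro continuous_intros assms)

lemma norm_character [simp]: "cmod (character y x) = 1"
proof -
  have "character y x = exp (\<i> * of_real (2 * pi * (y \<bullet> x)))"
    by (simp add: character_def mult_ac)
  then show ?thesis by (metis norm_exp_i_times)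
qed

lemma character_0 [simp]: "character 0 x = 1" "character y 0 = 1"
  by (simp_all add: character_def)

lemma character_add: "character (y + z) x = character y x * character z x"
  by (simp add: character_def exp_add[symmetric] inner_add_left algebra_simps)

lemma character_add_right: "character y (x + z) = character y x * character y z"
  by (simp add: character_def exp_add[symmetric] inner_add_right algebra_simps)

lemma character_minus: "character (- y) x = cnj (character y x)"
  by (simp add: character_def exp_cnj)

lemma character_minus_right: "character y (- x) = character (- y) x"
  by (simp add: character_def)

text \<open>Translation by a vector \<open>t\<close> with \<open>character y t = - 1\<close> negates the integral over a ball, but
  changes the ball only inside an annulus.\<close>

lemma has_mean_character:
  fixes y :: "real^'n::finite"
  assumes "y \<noteq> 0"
  shows "has_mean (character y) 0"
proof -
  \<comment> \<open>Chosen so that \<open>y \<bullet> t = 1/2\<close>, half a period of the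
    character.\<close>
  define t where "t = (1 / (2 * (y \<bullet> y))) *\<^sub>R y"
  have "character y t = exp (\<i> * of_real pi)"
    using assms by (simp add: character_def t_def mult_ac)
  then have t: "character y t = -1" by (metis exp_pi_i mult.commute)
  have bm: "(\<lambda>x. indicator (ball c R) x *\<^sub>R character y x) \<in> borel_measurable borel" for c R
    by (intro borel_measurable_scaleR borel_measurable_indicator borel_measurable_continuous_onI continuous_intros) auto
  have int: "integrable lborel (\<lambda>x. indicator (ball c R) x *\<^sub>R character y x)" for c R
    using set_integrable_ball_continuous[of "character y" c R] unfolding set_integrable_def
    by (simp add: continuous_intros)
  have bound: "cmod (LINT x:ball 0 R|lborel. character y x)
      \<le> measure lborel (annulus R (norm t) :: (real^'n) set)" for R
  proof -
    let ?A = "annulus R (norm t) :: (real^'n) set"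
    have shift: "(LINT x:ball t R|lborel. character y x) = - (LINT x:ball 0 R|lborel. character y x)"
    proof -
      have "(LINT x:ball t R|lborel. character y x)
          = (\<integral>x. indicator (ball t R) (t + x) *\<^sub>R character y (t + x) \<partial>lborel)"
        unfolding set_lebesgue_integral_def
        by (rule integral_lborel_translate[OF bm, symmetric])
      also have "\<dots> = (\<integral>x. - (indicator (ball 0 R) x *\<^sub>R character y x) \<partial>lborel)"
        by (rule Bochner_Integration.integral_cong)
           (auto simp: character_add_right t indicator_def dist_norm)
      finally show ?thesis by (simp add: set_lebesgue_integral_def)
    qed
    have "2 * cmod (LINT x:ball 0 R|lborel. character y x)
        = cmod ((LINT x:ball 0 R|lborel. character y x) - (LINT x:ball t R|lborel. character y x))"
      unfolding shift by (simp add: norm_mult flip: mult_2)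
    also have "\<dots> = cmod (\<integral>x. indicator (ball 0 R) x *\<^sub>R character y x - indicator (ball t R) x *\<^sub>R character y x \<partial>lborel)"
      unfolding set_lebesgue_integral_def
      by (subst Bochner_Integration.integral_diff) (auto intro: int)
    also have "\<dots> \<le> (\<integral>x. indicator ?A x \<partial>lborel)"
    proof -
      have pt: "cmod (indicator (ball 0 R) x *\<^sub>R character y x - indicator (ball t R) x *\<^sub>R character y x)
          \<le> indicator ?A x" for x
      proof -
        consider "norm x < R" "norm (t - x) < R" | "norm x < R" "\<not> norm (t - x) < R" |
          "\<not> norm x < R" "norm (t - x) < R" | "\<not> norm x < R" "\<not> norm (t - x) < R" by blast
        then show ?thesis
        proof cases
          case 2
          then have "x \<in> ?A"
            using norm_triangle_ineq4[of t x] norm_ge_zero[of t] by (simp add: annulus_def)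
          then show ?thesis using 2 by (simp add: indicator_def dist_norm)
        next
          case 3
          then have "x \<in> ?A"
            using norm_triangle_ineq4[of t "t - x"] norm_ge_zero[of t] by (simp add: annulus_def)
          then show ?thesis using 3 by (simp add: indicator_def dist_norm)
        qed (simp_all add: indicator_def dist_norm)
      qed
      have iA: "integrable lborel (indicator ?A :: _ \<Rightarrow> real)"
        using annulus_fmeasurable[where 'a="real^'n", of R "norm t"]
        by (intro integrable_real_indicator) (auto simp: fmeasurable_def)
      have "cmod (\<integral>x. indicator (ball 0 R) x *\<^sub>R character y x - indicator (ball t R) x *\<^sub>R character y x \<partial>lborel)
          \<le> (\<integral>x. cmod (indicator (ball 0 R) x *\<^sub>R character y x - indicator (ball t R) x *\<^sub>R character y x) \<partial>lborel)"
        by (rule integral_norm_bound)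
      also have "\<dots> \<le> (\<integral>x. indicator ?A x \<partial>lborel)"
        by (rule integral_mono[OF _ iA pt]) (rule integrable_norm[OF Bochner_Integration.integrable_diff[OF int int]])
      finally show ?thesis .
    qed
    also have "\<dots> = measure lborel ?A" by simp
    finally show ?thesis using norm_ge_zero[of "LINT x:ball 0 R|lborel. character y x"] by linarith
  qed
  have "(ball_mean (character y) \<longlongrightarrow> 0) at_top"
  proof (rule Lim_null_comparison[OF always_eventually annulus_ratio_tendsto[where 'a="real^'n", of "norm t"]], rule allI)
    fix R
    show "norm (ball_mean (character y) R) \<le> measure lborel (annulus R (norm t) :: (real^'n) set)
        / measure lborel (ball (0::real^'n) R)"
      using bound[of R] by (simp add: ball_mean_def norm_divide divide_right_mono)
  qed simp
  then show ?thesis by (simp add: has_mean_def)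
qed

subsection \<open>Bohr approximation\<close>

text \<open>The sets of nonnegative integer combinations of \<open>E\<close> with coefficients at most \<open>N\<close> grow
  polynomially in \<open>N\<close>, so not every step can enlarge them by the factor \<open>1 + d\<close>.\<close>

lemma foelner_set:
  fixes E :: "'a::real_vector set"
  assumes E: "finite E" and d: "d > 0"
  shows "\<exists>A. finite A \<and> A \<noteq> {} \<and> (\<forall>y\<in>E. real (card (A \<union> (+) y ` A)) \<le> (1 + d) * real (card A))"
proof -
  define S where "S N = (\<lambda>j. \<Sum>e\<in>E. real (j e) *\<^sub>R e) ` (PiE E (\<lambda>_. {..N::nat}))" for N
  have fin: "finite (S N)" for N
    unfolding S_def using E by (intro finite_imageI finite_PiE) auto
  have ne: "S N \<noteq> {}" for N
    unfolding S_def by (simp add: PiE_eq_empty_iff)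
  have card: "real (card (S N)) \<le> (real N + 1) ^ card E" for N
  proof -
    have "card (S N) \<le> card (PiE E (\<lambda>_. {..N}))"
      unfolding S_def using E by (intro card_image_le finite_PiE) auto
    also have "\<dots> = (N + 1) ^ card E" using E by (simp add: card_PiE)
    finally have "real (card (S N)) \<le> real ((N + 1) ^ card E)" using of_nat_mono by blast
    then show ?thesis by (simp add: add.commute)
  qed
  have step: "S N \<union> (+) y ` S N \<subseteq> S (Suc N)" if y: "y \<in> E" for N y
  proof -
    have "S N \<subseteq> S (Suc N)"
      unfolding S_def by (intro image_mono PiE_mono) auto
    moreover have "(+) y ` S N \<subseteq> S (Suc N)"
    proof
      fix z assume "z \<in> (+) y ` S N"
      then obtain j where j: "j \<in> PiE E (\<lambda>_. {..N})" "z = y + (\<Sum>e\<in>E. real (j e) *\<^sub>R e)"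
        unfolding S_def by auto
      \<comment> \<open>Adding \<open>y\<close> raises its coefficient by one, which still fits into
        the range up to \<open>Suc N\<close>.\<close>
      let ?j = "j(y := Suc (j y))"
      have "?j \<in> PiE E (\<lambda>_. {..Suc N})"
        using j(1) y by (auto simp: PiE_iff extensional_def le_SucI)
      moreover have "z = (\<Sum>e\<in>E. real (?j e) *\<^sub>R e)"
        using E y unfolding j(2) sum.remove[OF E y] by (simp add: scaleR_add_left)
      ultimately show "z \<in> S (Suc N)" unfolding S_def by blast
    qed
    ultimately show ?thesis by blast
  qed
  have "\<exists>N. real (card (S (Suc N))) \<le> (1 + d) * real (card (S N))"
  proof (rule ccontr)
    assume "\<not> ?thesis"
    then have grow: "real (card (S (Suc N))) > (1 + d) * real (card (S N))" for N
      by (auto simp: not_le)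
    have low: "(1 + d) ^ N \<le> real (card (S N))" for N
    proof (induction N)
      case 0
      have "0 < card (S 0)" using fin ne by (simp add: card_gt_0_iff)
      then show ?case by simp
    next
      case (Suc N)
      then have "(1 + d) ^ Suc N \<le> (1 + d) * real (card (S N))" using d by simp
      with grow[of N] show ?case by linarith
    qed
    \<comment> \<open>Growth at every step forces \<open>(1 + d) ^ N \<le> (N + 1) ^ card E\<close>
      for all \<open>N\<close>; after taking logarithms this contradicts that
      \<open>ln N / N\<close> tends to zero.\<close>
    have "(\<lambda>N. real (card E) * (ln (real (Suc N)) / real (Suc N))) \<longlonglongrightarrow> real (card E) * 0"
      by (intro tendsto_mult_left LIMSEQ_Suc lim_ln_over_n)
    then have "\<forall>\<^sub>F N in sequentially. real (card E) * (ln (real (Suc N)) / real (Suc N)) < ln (1 + d) / 2"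
      by (rule order_tendstoD) (use d in simp)
    \<comment> \<open>\<open>N \<ge> 1\<close> gives \<open>(N + 1) / 2 \<le> N\<close>, which
      closes the chain of inequalities below.\<close>
    then have "\<forall>\<^sub>F N in sequentially. real (card E) * (ln (real (Suc N)) / real (Suc N)) < ln (1 + d) / 2 \<and> N \<ge> 1"
      by (intro eventually_conj eventually_ge_at_top)
    from eventually_happens'[OF sequentially_bot this]
    obtain N where N: "real (card E) * (ln (real (Suc N)) / real (Suc N)) < ln (1 + d) / 2" "N \<ge> 1"
      by blast
    have "ln ((1 + d) ^ N) \<le> ln ((real N + 1) ^ card E)"
      using low[of N] card[of N] d by (subst ln_le_cancel_iff) auto
    then have "real N * ln (1 + d) \<le> real (card E) * ln (real (Suc N))"
      using d by (simp add: ln_realpow add.commute)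
    also have "\<dots> < real (Suc N) * (ln (1 + d) / 2)"
      using N(1) by (simp add: field_simps)
    also have "\<dots> \<le> real N * ln (1 + d)"
      using N(2) d mult_right_mono[of 1 "real N" "ln (1 + d)"] by (simp add: algebra_simps)
    finally show False by simp
  qed
  then obtain N where N: "real (card (S (Suc N))) \<le> (1 + d) * real (card (S N))" by blast
  have "real (card (S N \<union> (+) y ` S N)) \<le> (1 + d) * real (card (S N))" if "y \<in> E" for y
    using card_mono[OF fin step[OF that, of N]] N by linarith
  then show ?thesis by (intro exI[of _ "S N"] conjI ballI fin ne)
qed

text \<open>The kernel is \<open>\<bar>\<Sum>a\<in>A. character a\<bar>\<^sup>2 / card A\<close> for a Foelner set \<open>A\<close>; unlike the Bochner-Fejer
  kernels it needs no rational basis of the frequencies.\<close>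

lemma positive_kernel:
  fixes E :: "(real^'n::finite) set"
  assumes E: "finite E" and d: "d > 0"
  shows "\<exists>k D w. finite D \<and> (\<forall>s. 0 \<le> k s) \<and>
      (\<forall>s. complex_of_real (k s) = (\<Sum>y\<in>D. of_real (w y) * character y s)) \<and>
      (\<forall>y. y \<notin> D \<longrightarrow> w y = 0) \<and> w 0 = (1::real) \<and> (\<forall>y\<in>E. \<bar>w y - 1\<bar> \<le> d)"
proof -
  obtain A where A: "finite A" "A \<noteq> {}"
    "\<And>y. y \<in> E \<Longrightarrow> real (card (A \<union> (+) y ` A)) \<le> (1 + d) * real (card A)"
    using foelner_set[OF E d] by blast
  have cA: "card A > 0" using A by (simp add: card_gt_0_iff)
  define P where "P y = {ab \<in> A \<times> A. fst ab - snd ab = y}" for y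
  define D where "D = (\<lambda>ab. fst ab - snd ab) ` (A \<times> A)"
  define w where "w y = real (card (P y)) / real (card A)" for y
  define k where "k s = (cmod (\<Sum>a\<in>A. character a s))\<^sup>2 / real (card A)" for s
  have finD: "finite D" using A by (simp add: D_def)
  \<comment> \<open>In a pair of difference \<open>y\<close> the first entry determines the second,
    so the pairs are counted by their first entries.\<close>
  have cardP: "card (P y) = card (A \<inter> (+) y ` A)" for y
  proof -
    have "bij_betw fst (P y) (A \<inter> (+) y ` A)"
    proof (rule bij_betwI[where g="\<lambda>a. (a, a - y)"])
      show "fst \<in> P y \<rightarrow> A \<inter> (+) y ` A"
      proof
        fix ab assume "ab \<in> P y"
        then have "fst ab = y + snd ab" "fst ab \<in> A" "snd ab \<in> A" by (auto simp: P_def)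
        then show "fst ab \<in> A \<inter> (+) y ` A" by auto
      qed
    qed (auto simp: P_def)
    then show ?thesis by (rule bij_betw_same_card)
  qed
  have "complex_of_real (k s) = (\<Sum>y\<in>D. of_real (w y) * character y s)" for s
  proof -
    have "complex_of_real ((cmod (\<Sum>a\<in>A. character a s))\<^sup>2)
        = (\<Sum>a\<in>A. character a s) * (\<Sum>b\<in>A. character (- b) s)"
      by (simp add: complex_norm_square character_minus del: of_real_power)
    also have "\<dots> = (\<Sum>ab\<in>A \<times> A. character (fst ab - snd ab) s)"
      by (simp add: sum_product sum.cartesian_product case_prod_beta flip: character_add)
    also have "\<dots> = (\<Sum>y\<in>D. \<Sum>ab\<in>P y. character (fst ab - snd ab) s)"
      unfolding D_def P_def using A by (intro sum.image_gen) auto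
    also have "\<dots> = (\<Sum>y\<in>D. of_nat (card (P y)) * character y s)"
      by (intro sum.cong refl) (simp add: P_def)
    finally show ?thesis
      using cA by (simp add: k_def w_def sum_divide_distrib)
  qed
  moreover have "w y = 0" if "y \<notin> D" for y
  proof -
    have "P y = {}" using that unfolding P_def D_def by force
    then show ?thesis by (simp add: w_def)
  qed
  moreover have "w 0 = 1"
    using cA by (simp add: w_def cardP)
  \<comment> \<open>Inclusion-exclusion turns the upper bound on the union of \<open>A\<close> with
    its translate into a lower bound on their intersection, whose relative size is
    \<open>w y\<close>.\<close>
  moreover have "\<bar>w y - 1\<bar> \<le> d" if y: "y \<in> E" for y
  proof -
    have "card ((+) y ` A) = card A" by (simp add: card_image)
    then have "card (A \<union> (+) y ` A) + card (A \<inter> (+) y ` A) = card A + card A"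
      using card_Un_Int[of A "(+) y ` A"] A by simp
    then have "real (card (P y)) \<ge> (1 - d) * real (card A)"
      using A(3)[OF y] unfolding cardP by (simp add: algebra_simps flip: of_nat_add)
    moreover have "card (P y) \<le> card A"
      unfolding cardP using A by (intro card_mono) auto
    ultimately show ?thesis
      using cA d by (simp add: w_def abs_le_iff field_simps)
  qed
  moreover have "0 \<le> k s" for s by (simp add: k_def)
  ultimately have "finite D \<and> (\<forall>s. 0 \<le> k s) \<and>
      (\<forall>s. complex_of_real (k s) = (\<Sum>y\<in>D. of_real (w y) * character y s)) \<and>
      (\<forall>y. y \<notin> D \<longrightarrow> w y = 0) \<and> w 0 = (1::real) \<and> (\<forall>y\<in>E. \<bar>w y - 1\<bar> \<le> d)"
    using finD by (intro conjI allI ballI impI)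
  then show ?thesis by (intro exI)
qed

section \<open>Fourier coefficients of almost periodic functions\<close>

lemma bohr_ap_approx:
  assumes "F \<in> bohr_ap_functions" "e > 0"
  obtains E c where "finite E" "\<And>x. cmod (F x - (\<Sum>y\<in>E. c y * character y x)) \<le> e"
proof -
  obtain f where f: "F = apply_bcontfun f" "f \<in> closure trig_polynomials"
    using assms by (auto simp: bohr_ap_functions_def)
  then obtain p where p: "p \<in> trig_polynomials" "dist p f < e"
    using closure_approachable assms by blast
  obtain E c where E: "finite E" "\<And>x. apply_bcontfun p x = (\<Sum>y\<in>E. c y * character y x)"
    using p by (auto simp: trig_polynomials_def)
  have "cmod (F x - (\<Sum>y\<in>E. c y * character y x)) \<le> e" for x
    using dist_bounded[of p x f] p(2) by (simp add: f E(2)[symmetric] dist_norm norm_minus_commute)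
  then show thesis using E(1) that by blast
qed

lemma bohr_ap_continuous: "F \<in> bohr_ap_functions \<Longrightarrow> continuous_on UNIV F"
  by (auto simp: bohr_ap_functions_def)

lemma has_mean_character_0: "has_mean (character (0::real^'n::finite)) 1"
proof -
  have "character 0 = (\<lambda>x::real^'n. 1)" by auto
  then show ?thesis using has_mean_const by metis
qed

text \<open>Orthogonality of characters: in the product only the term with \<open>z = y\<close> has
  a nonconstant phase cancelled, and every other term has mean zero.\<close>

lemma has_mean_trig_polynomial:
  fixes E :: "(real^'n::finite) set"
  assumes "finite E"
  shows "has_mean (\<lambda>t. (\<Sum>z\<in>E. c z * character z t) * character (- y) t) (if y \<in> E then c y else 0)"
proof -
  have "has_mean (\<lambda>t. \<Sum>z\<in>E. c z * character (z - y) t) (\<Sum>z\<in>E. c z * (if z = y then 1 else 0))"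
  proof (intro has_mean_sum assms continuous_intros has_mean_cmult)
    fix z
    show "has_mean (character (z - y)) (if z = y then 1 else 0)"
      using has_mean_character[of "z - y"] has_mean_character_0 by auto
  qed
  moreover have "(\<Sum>z\<in>E. c z * (if z = y then 1 else 0)) = (if y \<in> E then c y else 0)"
    using assms by (simp add: if_distrib cong: if_cong)
  ultimately show ?thesis
    by (simp add: sum_distrib_right mult.assoc flip: character_add)
qed

text \<open>Multiplying by a character of modulus one preserves uniform approximation, so the
  product is a uniform limit of trigonometric polynomials.\<close>

lemma bohr_ap_mean_exists:
  assumes "F \<in> bohr_ap_functions"
  shows "\<exists>a. has_mean (\<lambda>t. F t * character (- y) t) a"
proof (rule mean_exists_uniform_limit)
  show "continuous_on UNIV (\<lambda>t. F t * character (- y) t)"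
    by (intro continuous_intros bohr_ap_continuous[OF assms])
  fix e :: real assume "e > 0"
  then obtain E c where E: "finite E" "\<And>x. cmod (F x - (\<Sum>y\<in>E. c y * character y x)) \<le> e"
    using bohr_ap_approx[OF assms] by blast
  show "\<exists>h c. continuous_on UNIV h \<and> has_mean h c \<and> (\<forall>x. cmod (F x * character (- y) x - h x) \<le> e)"
  proof (intro exI conjI allI)
    show "has_mean (\<lambda>t. (\<Sum>z\<in>E. c z * character z t) * character (- y) t) (if y \<in> E then c y else 0)"
      using has_mean_trig_polynomial[OF E(1)] .
    show "cmod (F x * character (- y) x - (\<Sum>z\<in>E. c z * character z x) * character (- y) x) \<le> e" for x
      using E(2)[of x] by (simp add: norm_mult flip: left_diff_distrib)
  qed (intro continuous_intros)
qed

text \<open>Each character splits as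
  \<open>character y (x - t) = character y x * character (- y) t\<close>, so averaging over
  \<open>t\<close> leaves the Fourier coefficients of \<open>G\<close> multiplied by the kernel
  weights.\<close>

lemma has_mean_kernel_product:
  fixes G :: "real^'n::finite \<Rightarrow> complex"
  assumes "finite D" "\<And>s. K s = (\<Sum>y\<in>D. w y * character y s)" "continuous_on UNIV G"
    "\<And>y. y \<in> D \<Longrightarrow> has_mean (\<lambda>t. G t * character (- y) t) (m y)"
  shows "has_mean (\<lambda>t. G t * K (x - t)) (\<Sum>y\<in>D. w y * m y * character y x)"
proof -
  have "has_mean (\<lambda>t. \<Sum>y\<in>D. (w y * character y x) * (G t * character (- y) t))
     (\<Sum>y\<in>D. (w y * character y x) * m y)"
    by (intro has_mean_sum has_mean_cmult continuous_intros assms)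
  moreover have "G t * K (x - t) = (\<Sum>y\<in>D. (w y * character y x) * (G t * character (- y) t))" for t
  proof -
    have "character y (x - t) = character y x * character (- y) t" for y
      using character_add_right[of y x "- t"] by (simp add: character_minus_right)
    then show ?thesis by (simp add: assms(2) sum_distrib_left mult_ac)
  qed
  ultimately show ?thesis by (simp add: mult_ac)
qed

text \<open>An arbitrary approximating polynomial \<open>p\<close> may contain foreign frequencies.
  Convolution of \<open>F\<close> with a positive kernel gives a polynomial \<open>T\<close> whose
  coefficients are weighted Fourier coefficients of \<open>F\<close>. As the kernel has mean one,
  \<open>T\<close> is as close to the convolution \<open>q\<close> of \<open>p\<close> as
  \<open>F\<close> is to \<open>p\<close>; as its weights are near one on \<open>E\<close>,
  \<open>q\<close> is close to \<open>p\<close>.\<close>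

theorem bohr_approximation:
  fixes F :: "real^'n::finite \<Rightarrow> complex"
  assumes F: "F \<in> bohr_ap_functions" and e: "e > 0"
  obtains D c where "finite D" "\<And>y. y \<in> D \<Longrightarrow> \<not> has_mean (\<lambda>t. F t * character (- y) t) 0"
    "\<And>x. cmod (F x - (\<Sum>y\<in>D. c y * character y x)) \<le> e"
proof -
  obtain E c where E: "finite E" "\<And>x. cmod (F x - (\<Sum>y\<in>E. c y * character y x)) \<le> e/3"
    using bohr_ap_approx[OF F, of "e/3"] e by auto
  define p where "p x = (\<Sum>y\<in>E. c y * character y x)" for x
  define C where "C = (\<Sum>y\<in>E. cmod (c y))"
  have C: "C \<ge> 0" by (auto simp: C_def intro: sum_nonneg)
  \<comment> \<open>With this tolerance, replacing all weights on \<open>E\<close> by one costs at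
    most \<open>e/3\<close>; the summand one in \<open>C + 1\<close> covers
    \<open>C = 0\<close>.\<close>
  obtain k D w where k: "finite D" "\<And>s. 0 \<le> k s"
      "\<And>s. complex_of_real (k s) = (\<Sum>y\<in>D. of_real (w y) * character y s)"
      "\<And>y. y \<notin> D \<Longrightarrow> w y = 0" "w 0 = (1::real)" "\<And>y. y \<in> E \<Longrightarrow> \<bar>w y - 1\<bar> \<le> e / 3 / (C + 1)"
  proof -
    have "e / 3 / (C + 1) > 0" using e C by simp
    from positive_kernel[OF E(1) this] show thesis using that by blast
  qed
  obtain m where m: "\<And>y. has_mean (\<lambda>t. F t * character (- y) t) (m y)"
    using bohr_ap_mean_exists[OF F] by metis
  have contF: "continuous_on UNIV F" using F by (rule bohr_ap_continuous)
  have contp: "continuous_on UNIV p" unfolding p_def by (intro continuous_intros)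
  have contk: "continuous_on UNIV k"
  proof -
    have "k = (\<lambda>s. Re (\<Sum>y\<in>D. of_real (w y) * character y s))"
      by (metis Re_complex_of_real k(3))
    then show ?thesis by (auto intro!: continuous_intros)
  qed
  have contkx: "continuous_on UNIV (\<lambda>t. k (x - t))" for x
    by (rule continuous_on_compose2[OF contk, of UNIV "\<lambda>t. x - t"]) (auto intro!: continuous_intros)
  define T where "T x = (\<Sum>y\<in>D. of_real (w y) * m y * character y x)" for x
  define q where "q x = (\<Sum>y\<in>D. of_real (w y) * (if y \<in> E then c y else 0) * character y x)" for x
  \<comment> \<open>\<open>T\<close> and \<open>q\<close> are the convolutions of \<open>F\<close> and \<open>p\<close> with the kernel \<open>k\<close>.\<close>
  have Tq: "cmod (T x - q x) \<le> e/3" for x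
  proof (rule norm_mean_le)
    show "has_mean (\<lambda>t. F t * of_real (k (x - t)) - p t * of_real (k (x - t))) (T x - q x)"
      unfolding T_def q_def
      by (intro has_mean_diff has_mean_kernel_product[OF k(1,3)] contF contp m continuous_intros contkx)
         (simp add: p_def has_mean_trig_polynomial[OF E(1)])
    have "has_mean (\<lambda>t. 1 * of_real (k (x - t))) (\<Sum>y\<in>D. of_real (w y) * (if y = 0 then 1 else 0) * character y x)"
      using has_mean_character[of "- y" for y] has_mean_const[where 'a="real^'n", of 1]
      by (intro has_mean_kernel_product[OF k(1,3)]) auto
    \<comment> \<open>Since \<open>w 0 = 1\<close> and weights vanish off \<open>D\<close>, the
      frequency zero belongs to \<open>D\<close>.\<close>
    moreover have "(\<Sum>y\<in>D. of_real (w y) * (if y = 0 then 1 else 0) * character y x) = 1"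
      using k(1) k(4)[of 0] k(5) by (auto simp: if_distrib if_distribR cong: if_cong)
    ultimately show "has_mean (\<lambda>t. complex_of_real (k (x - t))) 1" by simp
    show "cmod (F t * of_real (k (x - t)) - p t * of_real (k (x - t))) \<le> e/3 * k (x - t)" for t
    proof -
      have "cmod (F t * of_real (k (x - t)) - p t * of_real (k (x - t))) = cmod (F t - p t) * k (x - t)"
        using k(2)[of "x - t"] by (simp add: norm_mult flip: left_diff_distrib)
      then show ?thesis using mult_right_mono[OF E(2)[of t] k(2)[of "x - t"]] by (simp add: p_def)
    qed
    show "continuous_on UNIV (\<lambda>t. F t * of_real (k (x - t)) - p t * of_real (k (x - t)))"
      by (intro continuous_on_diff continuous_on_mult continuous_on_of_real contF contp contkx)
    show "continuous_on UNIV (\<lambda>t. k (x - t))" by (rule contkx)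
    show "0 \<le> e / 3" using e by simp
  qed
  have qp: "cmod (q x - p x) \<le> e/3" for x
  proof -
    have "q x = (\<Sum>y\<in>E. of_real (w y) * c y * character y x)"
    proof -
      have "q x = (\<Sum>y\<in>D \<inter> E. of_real (w y) * c y * character y x)"
        unfolding q_def using k(1) by (intro sum.mono_neutral_cong_right) auto
      also have "\<dots> = (\<Sum>y\<in>E. of_real (w y) * c y * character y x)"
        using E(1) k(4) by (intro sum.mono_neutral_left) auto
      finally show ?thesis .
    qed
    then have "q x - p x = (\<Sum>y\<in>E. of_real (w y - 1) * c y * character y x)"
      by (simp add: p_def sum_subtractf algebra_simps)
    also have "cmod \<dots> \<le> (\<Sum>y\<in>E. e / 3 / (C + 1) * cmod (c y))"
    proof (rule sum_norm_le)
      fix y assume "y \<in> E"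
      then have "\<bar>w y - 1\<bar> * cmod (c y) \<le> e / 3 / (C + 1) * cmod (c y)"
        by (intro mult_right_mono k(6)) auto
      then show "cmod (of_real (w y - 1) * c y * character y x) \<le> e / 3 / (C + 1) * cmod (c y)"
        by (simp only: norm_mult norm_of_real norm_character mult_1_right)
    qed
    also have "\<dots> = e / 3 / (C + 1) * C" by (simp add: C_def sum_distrib_left)
    also have "\<dots> \<le> e / 3" using C e by (simp add: field_simps)
    finally show ?thesis .
  qed
  have FT: "cmod (F x - T x) \<le> e" for x
  proof -
    have "cmod (F x - T x) \<le> cmod (F x - p x) + cmod (q x - p x) + cmod (T x - q x)"
      using norm_triangle_ineq4[of "F x - p x - (q x - p x)" "T x - q x"]
        norm_triangle_ineq4[of "F x - p x" "q x - p x"] by simp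
    then show ?thesis using Tq[of x] qp[of x] E(2)[of x] by (simp add: p_def)
  qed
  show thesis
  proof (rule that)
    \<comment> \<open>Discarding the frequencies with vanishing Fourier coefficient of
      \<open>F\<close> does not change \<open>T\<close>.\<close>
    show "finite {y \<in> D. m y \<noteq> 0}" using k(1) by simp
    show "\<not> has_mean (\<lambda>t. F t * character (- y) t) 0" if "y \<in> {y \<in> D. m y \<noteq> 0}" for y
      using has_mean_unique[OF m[of y]] that by auto
    have TT: "T x = (\<Sum>y\<in>{y \<in> D. m y \<noteq> 0}. of_real (w y) * m y * character y x)" for x
      unfolding T_def using k(1) by (intro sum.mono_neutral_right) auto
    show "cmod (F x - (\<Sum>y\<in>{y \<in> D. m y \<noteq> 0}. of_real (w y) * m y * character y x)) \<le> e" for x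
      using FT[of x] unfolding TT .
  qed
qed

subsection \<open>Fourier coefficients and the spectrum\<close>

lemma R1_le_norm_diff:
  assumes "a \<in> \<Lambda>" "b \<in> \<Lambda>" "a \<noteq> b"
  shows "R1 \<Lambda> \<le> norm (a - b)"
  unfolding R1_def
proof (rule cInf_lower)
  show "norm (a - b) \<in> {norm (b - a) |a b. a \<in> \<Lambda> \<and> b \<in> \<Lambda> \<and> a \<noteq> b}" using assms by blast
  show "bdd_below {norm (b - a) |a b. a \<in> \<Lambda> \<and> b \<in> \<Lambda> \<and> a \<noteq> b}"
    by (rule bdd_belowI[of _ 0]) auto
qed

text \<open>Balls of radius \<open>r/2\<close> about the points are disjoint, so their volumes add
  up inside \<open>B\<close>. The bound is uniform over finite subsets of \<open>X\<close>, which
  makes \<open>X\<close> itself finite.\<close>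

lemma packing_bound:
  fixes X B :: "'a::euclidean_space set"
  assumes r: "r > 0" and sep: "\<And>a b. a \<in> X \<Longrightarrow> b \<in> X \<Longrightarrow> a \<noteq> b \<Longrightarrow> r \<le> norm (a - b)"
    and B: "B \<in> fmeasurable lborel" and sub: "\<And>a. a \<in> X \<Longrightarrow> ball a (r/2) \<subseteq> B"
  shows "finite X \<and> real (card X) * measure lborel (ball (0::'a) (r/2)) \<le> measure lborel B"
proof -
  let ?v = "measure lborel (ball (0::'a) (r/2))"
  have v: "?v > 0" using r by (simp add: measure_ball_pos)
  have fm: "ball a (r/2) \<in> fmeasurable lborel" for a :: 'a
    using emeasure_lborel_ball_finite[of a "r/2"] by (auto simp: fmeasurable_def)
  have G: "real (card G) * ?v \<le> measure lborel B" if "G \<subseteq> X" "finite G" for G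
  proof -
    have "pairwise (\<lambda>a b. disjnt (ball a (r/2)) (ball b (r/2))) G"
      unfolding pairwise_def
    proof (intro ballI impI)
      fix a b assume "a \<in> G" "b \<in> G" "a \<noteq> b"
      then have "r \<le> dist a b" using sep that by (auto simp: dist_norm)
      then show "disjnt (ball a (r/2)) (ball b (r/2))"
        unfolding disjnt_def by (intro disjoint_ballI) auto
    qed
    then have "measure lborel (\<Union>a\<in>G. ball a (r/2)) = (\<Sum>a\<in>G. measure lborel (ball a (r/2)))"
      by (intro measure_UNION' that fm)
    also have "\<dots> = (\<Sum>a\<in>G. ?v)"
      using r by (intro sum.cong refl) (simp add: content_ball)
    finally have "real (card G) * ?v = measure lborel (\<Union>a\<in>G. ball a (r/2))" by simp
    also have "\<dots> \<le> measure lborel B"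
      using B sub that by (intro measure_mono_fmeasurable) auto
    finally show ?thesis .
  qed
  have "finite X"
  proof -
    have "card G \<le> nat \<lfloor>measure lborel B / ?v\<rfloor>" if "G \<subseteq> X" "finite G" for G
      using G[OF that] v by (simp add: le_nat_floor pos_le_divide_eq)
    from finite_if_finite_subsets_card_bdd[OF this] show ?thesis by blast
  qed
  then show ?thesis using G by blast
qed

text \<open>Integrating the sum termwise over \<open>ball 0 R\<close>, each point deep inside
  contributes \<open>character (- y) l\<close> times the transform of \<open>f\<close>. Points
  within \<open>c\<close> of the sphere contribute boundedly, and by packing their number is bounded
  by a multiple of the volume of an annulus, which is negligible against the ball.\<close>

lemma mu_conv_mean_density:
  fixes f :: "real^'n::finite \<Rightarrow> complex" and y :: "real^'n"
  assumes r: "r > 0" and sep: "\<And>a b. a \<in> \<Lambda> \<Longrightarrow> b \<in> \<Lambda> \<Longrightarrow> a \<noteq> b \<Longrightarrow> r \<le> norm (a - b)"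
    and f: "continuous_on UNIV f" and c: "c > 0" and supp: "\<And>x. c \<le> norm x \<Longrightarrow> f x = 0"
    and mean: "has_mean (\<lambda>x. mu_conv \<Lambda> f x * character (- y) x) a"
  shows "((\<lambda>R. (\<Sum>l\<in>\<Lambda> \<inter> ball 0 R. character (- y) l) * (\<integral>x. f x * character (- y) x \<partial>lborel)
            / of_real (measure lborel (ball (0::real^'n) R))) \<longlongrightarrow> a) at_top"
proof -
  define I where "I = (\<integral>x. f x * character (- y) x \<partial>lborel)"
  define J where "J = (\<integral>x. cmod (f x) \<partial>lborel)"
  define v where "v = measure lborel (ball (0::real^'n) (r/2))"
  have v: "v > 0" unfolding v_def using r by (simp add: measure_ball_pos)
  have intf: "integrable lborel f"
  proof -
    have "integrable lborel (\<lambda>x. indicator (cball 0 c) x *\<^sub>R f x)"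
      by (intro borel_integrable_compact continuous_on_subset[OF f]) auto
    also have "(\<lambda>x. indicator (cball 0 c) x *\<^sub>R f x) = f"
      using supp by (auto simp: indicator_def fun_eq_iff)
    finally show ?thesis .
  qed
  define h where "h l x = f (x - l) * character (- y) x" for l x
  have conth: "continuous_on UNIV (h l)" for l
    unfolding h_def by (intro continuous_intros continuous_on_compose2[OF f]) auto
  have bmh: "h l \<in> borel_measurable borel" for l
    by (rule borel_measurable_continuous_onI[OF conth])
  have hshift: "h l (l + x) = character (- y) l * (f x * character (- y) x)" for l x
    by (simp add: h_def character_add_right)
  have inth: "(\<integral>x. h l x \<partial>lborel) = character (- y) l * I" for l
    using integral_lborel_translate[OF bmh, of l l] by (simp add: hshift I_def)
  have normh: "(\<integral>x. cmod (h l x) \<partial>lborel) = J" for l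
    using integral_lborel_translate[of "\<lambda>x. cmod (h l x)" l] bmh
    by (simp add: hshift J_def norm_mult)
  have ih: "integrable lborel (h l)" for l
  proof -
    have "integrable (distr lborel borel ((+) (- l))) f"
      unfolding lborel_distr_plus by (rule intf)
    then have "integrable lborel (\<lambda>x. f (- l + x))"
      using f by (subst (asm) integrable_distr_eq) (auto intro: borel_measurable_continuous_onI)
    then show ?thesis
      by (rule Bochner_Integration.integrable_bound)
         (use bmh in \<open>auto simp: h_def norm_mult\<close>)
  qed
  \<comment> \<open>The contribution of the point \<open>l\<close> after truncation to the
    ball.\<close>
  define g where "g R l = (LINT x:ball 0 R|lborel. h l x)" for R l
  have gJ: "cmod (g R l) \<le> J" for R l
  proof -
    have si: "set_integrable lborel (ball 0 R) (h l)"
      by (rule set_integrable_ball_continuous[OF conth])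
    have "cmod (g R l) \<le> (LINT x:ball 0 R|lborel. cmod (h l x))"
      unfolding g_def by (rule set_integral_norm_bound[OF si])
    also have "\<dots> \<le> (\<integral>x. cmod (h l x) \<partial>lborel)"
      unfolding set_lebesgue_integral_def using set_integrable_norm[OF si] ih[of l]
      by (intro integral_mono) (auto simp: set_integrable_def indicator_def)
    finally show ?thesis by (simp add: normh)
  qed
  have IJ: "cmod (character (- y) l * I) \<le> J" for l
    using integral_norm_bound[of lborel "h l"] by (simp add: inth normh)
  have gin: "g R l = character (- y) l * I" if "l \<in> ball 0 (R - c)" for R l
  proof -
    have "indicator (ball 0 R) x *\<^sub>R h l x = h l x" for x
    proof (cases "norm x < R")
      case False
      then have "c \<le> norm (x - l)" using that norm_triangle_ineq2[of x l] by simp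
      then show ?thesis using supp by (simp add: h_def)
    qed simp
    then show ?thesis by (simp add: g_def set_lebesgue_integral_def inth)
  qed
  have finL: "finite (\<Lambda> \<inter> ball 0 R)" for R
  proof -
    have "ball (0::real^'n) (R + r) \<in> fmeasurable lborel"
      using emeasure_lborel_ball_finite[of "0::real^'n"] by (auto simp: fmeasurable_def)
    moreover have "ball l (r/2) \<subseteq> ball 0 (R + r)" if "l \<in> \<Lambda> \<inter> ball 0 R" for l
      using that r by (auto simp: ball_subset_ball_iff)
    ultimately show ?thesis
      using packing_bound[of r "\<Lambda> \<inter> ball 0 R" "ball 0 (R + r)"] r sep by blast
  qed
  \<comment> \<open>Widening the annulus from \<open>c\<close> to \<open>c + r\<close> makes room
    for the disjoint balls of radius \<open>r/2\<close>.\<close>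
  have cardA: "real (card (\<Lambda> \<inter> annulus R c)) * v \<le> measure lborel (annulus R (c + r) :: (real^'n) set)" for R
  proof -
    have "ball l (r/2) \<subseteq> annulus R (c + r)" if "l \<in> \<Lambda> \<inter> annulus R c" for l
    proof
      fix x assume x: "x \<in> ball l (r/2)"
      then have "norm x < norm l + r/2" "norm l < norm x + r/2"
        using norm_triangle_ineq2[of x l] norm_triangle_ineq2[of l x] by (auto simp: dist_norm norm_minus_commute)
      then show "x \<in> annulus R (c + r)" using that r by (auto simp: annulus_def)
    qed
    then show ?thesis
      unfolding v_def using packing_bound[of r "\<Lambda> \<inter> annulus R c" "annulus R (c + r)"] r sep by auto
  qed
  have integ: "(LINT x:ball 0 R|lborel. mu_conv \<Lambda> f x * character (- y) x) = (\<Sum>l\<in>\<Lambda> \<inter> ball 0 (R + c). g R l)" for R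
  proof -
    have "mu_conv \<Lambda> f x * character (- y) x = (\<Sum>l\<in>\<Lambda> \<inter> ball 0 (R + c). h l x)" if "x \<in> ball 0 R" for x
    proof -
      have "f (x - l) = 0" if "l \<in> \<Lambda> - \<Lambda> \<inter> ball 0 (R + c)" for l
        using that \<open>x \<in> ball 0 R\<close> norm_triangle_ineq2[of l x]
        by (intro supp) (auto simp: norm_minus_commute)
      then have "mu_conv \<Lambda> f x = (\<Sum>\<^sub>\<infinity>l\<in>\<Lambda> \<inter> ball 0 (R + c). f (x - l))"
        unfolding mu_conv_def by (intro infsum_cong_neutral) auto
      also have "\<dots> = (\<Sum>l\<in>\<Lambda> \<inter> ball 0 (R + c). f (x - l))" by (rule infsum_finite[OF finL])
      finally show ?thesis by (simp add: h_def sum_distrib_right)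
    qed
    then have "(LINT x:ball 0 R|lborel. mu_conv \<Lambda> f x * character (- y) x)
        = (LINT x:ball 0 R|lborel. (\<Sum>l\<in>\<Lambda> \<inter> ball 0 (R + c). h l x))"
      by (intro set_lebesgue_integral_cong) auto
    also have "\<dots> = (\<Sum>l\<in>\<Lambda> \<inter> ball 0 (R + c). g R l)"
      unfolding g_def set_lebesgue_integral_def scaleR_sum_right
      using set_integrable_ball_continuous[OF conth]
      by (intro Bochner_Integration.integral_sum) (auto simp: set_integrable_def)
    finally show ?thesis .
  qed
  define E where "E R = (LINT x:ball 0 R|lborel. mu_conv \<Lambda> f x * character (- y) x)
      - (\<Sum>l\<in>\<Lambda> \<inter> ball 0 R. character (- y) l) * I" for R
  have E: "cmod (E R) \<le> 2 * J / v * measure lborel (annulus R (c + r) :: (real^'n) set)" for R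
  proof -
    have J0: "J \<ge> 0" unfolding J_def by simp
    let ?G = "\<Lambda> \<inter> ball 0 (R + c)"
    have "(\<Sum>l\<in>\<Lambda> \<inter> ball 0 R. character (- y) l) * I = (\<Sum>l\<in>\<Lambda> \<inter> ball 0 R. character (- y) l * I)"
      by (simp add: sum_distrib_right)
    also have "\<dots> = (\<Sum>l\<in>?G. if l \<in> ball 0 R then character (- y) l * I else 0)"
      using c finL by (intro sum.mono_neutral_cong_left) auto
    finally have "E R = (\<Sum>l\<in>?G. g R l - (if l \<in> ball 0 R then character (- y) l * I else 0))"
      unfolding E_def integ by (simp add: sum_subtractf)
    \<comment> \<open>For \<open>l\<close> in \<open>ball 0 (R - c)\<close> truncation removes
      nothing, so the two terms cancel.\<close>
    also have "\<dots> = (\<Sum>l\<in>\<Lambda> \<inter> annulus R c. g R l - (if l \<in> ball 0 R then character (- y) l * I else 0))"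
    proof (rule sum.mono_neutral_right[OF finL])
      show "\<Lambda> \<inter> annulus R c \<subseteq> ?G" by (auto simp: annulus_def)
      show "\<forall>l\<in>?G - \<Lambda> \<inter> annulus R c. g R l - (if l \<in> ball 0 R then character (- y) l * I else 0) = 0"
        using c gin by (auto simp: annulus_def)
    qed
    also have "cmod \<dots> \<le> (\<Sum>l\<in>\<Lambda> \<inter> annulus R c. 2 * J)"
    proof (rule sum_norm_le)
      fix l
      show "cmod (g R l - (if l \<in> ball 0 R then character (- y) l * I else 0)) \<le> 2 * J"
        using gJ[of R l] IJ[of l] J0
          norm_triangle_ineq4[of "g R l" "if l \<in> ball 0 R then character (- y) l * I else 0"]
        by (auto split: if_splits)
    qed
    also have "\<dots> = 2 * J / v * (real (card (\<Lambda> \<inter> annulus R c)) * v)" using v by simp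
    also have "\<dots> \<le> 2 * J / v * measure lborel (annulus R (c + r) :: (real^'n) set)"
      using v J0 cardA by (intro mult_left_mono) auto
    finally show ?thesis .
  qed
  have "((\<lambda>R. E R / of_real (measure lborel (ball (0::real^'n) R))) \<longlongrightarrow> 0) at_top"
  proof (rule Lim_null_comparison[OF always_eventually])
    show "\<forall>R. cmod (E R / of_real (measure lborel (ball (0::real^'n) R)))
        \<le> 2 * J / v * (measure lborel (annulus R (c + r) :: (real^'n) set) / measure lborel (ball (0::real^'n) R))"
    proof
      fix R
      show "cmod (E R / of_real (measure lborel (ball (0::real^'n) R)))
        \<le> 2 * J / v * (measure lborel (annulus R (c + r) :: (real^'n) set) / measure lborel (ball (0::real^'n) R))"
        using divide_right_mono[OF E[of R], of "measure lborel (ball (0::real^'n) R)"]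
        by (simp add: norm_divide)
    qed
    show "((\<lambda>R. 2 * J / v * (measure lborel (annulus R (c + r) :: (real^'n) set) / measure lborel (ball (0::real^'n) R))) \<longlongrightarrow> 0) at_top"
      using tendsto_mult_left[OF annulus_ratio_tendsto[where 'a="real^'n", of "c + r"], of "2 * J / v"] c r by simp
  qed
  from tendsto_diff[OF mean[unfolded has_mean_def] this] show ?thesis
    unfolding I_def[symmetric] by (simp add: ball_mean_def E_def diff_divide_distrib)
qed

text \<open>A nonzero limit of the product forces the transform \<open>I\<close> of \<open>f\<close>
  to be nonzero. Dividing by it proves both that the density limit exists and that it is nonzero, as
  membership in the spectrum demands.\<close>

lemma mean_nonzero_in_spectrum:
  fixes f :: "real^'n::finite \<Rightarrow> complex" and y :: "real^'n"
  assumes r: "r > 0" and sep: "\<And>a b. a \<in> \<Lambda> \<Longrightarrow> b \<in> \<Lambda> \<Longrightarrow> a \<noteq> b \<Longrightarrow> r \<le> norm (a - b)"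
    and f: "continuous_on UNIV f" and c: "c > 0" and supp: "\<And>x. c \<le> norm x \<Longrightarrow> f x = 0"
    and mean: "has_mean (\<lambda>x. mu_conv \<Lambda> f x * character (- y) x) a" and "a \<noteq> 0"
  shows "y \<in> spectrum \<Lambda>"
proof -
  define I where "I = (\<integral>x. f x * character (- y) x \<partial>lborel)"
  define S where "S R = (\<Sum>l\<in>\<Lambda> \<inter> ball 0 R. character (- y) l) / of_real (measure lebesgue (ball (0::real^'n) R))" for R
  have lim: "((\<lambda>R. S R * I) \<longlongrightarrow> a) at_top"
    using mu_conv_mean_density[OF r sep f c supp mean]
    by (simp add: S_def I_def measure_completion)
  have I: "I \<noteq> 0"
  proof
    assume "I = 0"
    then have "((\<lambda>R::real. 0) \<longlongrightarrow> a) at_top" using lim by simp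
    then show False using \<open>a \<noteq> 0\<close> by (simp add: tendsto_const_iff)
  qed
  have "(S \<longlongrightarrow> a / I) at_top"
    using tendsto_divide[OF lim tendsto_const, of I] I by simp
  then have "has_mu_hat \<Lambda> y (a / I)"
    unfolding has_mu_hat_def S_def .
  then show ?thesis using I \<open>a \<noteq> 0\<close> by (auto simp: spectrum_def)
qed

subsection \<open>Components of uniformly transversal sets\<close>

text \<open>By \<open>lift\<close>, a small displacement in the base is realised by a small
  displacement inside \<open>X\<close>, which stays in the relatively open set.\<close>

lemma openin_proj_image:
  fixes p :: "'a::euclidean_space \<Rightarrow> 'a"
  assumes lin: "linear p"
    and lift: "\<And>e. e > 0 \<Longrightarrow> \<exists>d>0. \<forall>x\<in>X. \<forall>u\<in>range p. norm u < d \<longrightarrow>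
                 (\<exists>y\<in>X. p y = p x + u \<and> norm (y - x - u) < e)"
    and S: "openin (top_of_set X) S"
  shows "openin (top_of_set (range p)) (p ` S)"
  unfolding openin_euclidean_subtopology_iff
proof (intro conjI ballI)
  show "p ` S \<subseteq> range p" by auto
  fix w assume "w \<in> p ` S"
  then obtain x where x: "x \<in> S" "w = p x" by auto
  from S x obtain e where e: "e > 0" "\<And>y. y \<in> X \<Longrightarrow> dist y x < e \<Longrightarrow> y \<in> S" and xX: "x \<in> X"
    unfolding openin_euclidean_subtopology_iff by (meson subsetD)
  \<comment> \<open>One half of \<open>e\<close> is for the defect of the lift, the other for the
    displacement \<open>w' - w\<close>.\<close>
  obtain d where d: "d > 0" "\<And>x u. x \<in> X \<Longrightarrow> u \<in> range p \<Longrightarrow> norm u < d \<Longrightarrow>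
      (\<exists>y\<in>X. p y = p x + u \<and> norm (y - x - u) < e / 2)"
    using lift[of "e/2"] e(1) by (metis half_gt_zero)
  have "w' \<in> p ` S" if w': "w' \<in> range p" "dist w' w < min d (e/2)" for w'
  proof -
    have r: "w' - w \<in> range p" using w'(1) x(2) by (auto simp: linear_diff[OF lin, symmetric])
    obtain y where y: "y \<in> X" "p y = p x + (w' - w)" "norm (y - x - (w' - w)) < e/2"
      using d(2)[OF xX r] w' by (auto simp: dist_norm)
    have "norm (y - x) \<le> norm (y - x - (w' - w)) + norm (w' - w)"
      by (metis diff_add_cancel norm_triangle_ineq)
    also have "\<dots> < e" using y w' by (auto simp: dist_norm)
    finally have "y \<in> S" using e y by (auto simp: dist_norm)
    then show ?thesis using y x by (metis add_diff_cancel_left' diff_add_cancel image_eqI add.commute)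
  qed
  then show "\<exists>e>0. \<forall>x'\<in>range p. dist x' w < e \<longrightarrow> x' \<in> p ` S"
    using d e by (intro exI[of _ "min d (e/2)"]) auto
qed

text \<open>Fibres are uniformly discrete by \<open>sep\<close>, and displacements lift uniformly by
  \<open>lift\<close>, so \<open>p\<close> is a covering of the subspace \<open>range p\<close>. A
  subspace is simply connected, hence there is a section through any point of \<open>C\<close>; its
  image is connected and clopen in \<open>X\<close>, thus equal to \<open>C\<close>.\<close>

lemma component_graph_over_projection:
  fixes p :: "'a::euclidean_space \<Rightarrow> 'a"
  assumes lin: "linear p" and idem: "\<And>x. p (p x) = p x"
    and r: "r > 0"
    and sep: "\<And>x y. x \<in> X \<Longrightarrow> y \<in> X \<Longrightarrow> p x = p y \<Longrightarrow> x \<noteq> y \<Longrightarrow> r \<le> norm (x - y)"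
    and lift: "\<And>e. e > 0 \<Longrightarrow> \<exists>d>0. \<forall>x\<in>X. \<forall>u\<in>range p. norm u < d \<longrightarrow>
                 (\<exists>y\<in>X. p y = p x + u \<and> norm (y - x - u) < e)"
    and C: "C \<in> components X"
  shows "\<exists>s. homeomorphism (range p) C s p"
proof -
  let ?U = "range p"
  have contp: "continuous_on A p" for A
    using lin linear_continuous_on linear_linear by blast
  have sub: "subspace ?U" using lin linear_subspace_image subspace_UNIV by blast
  have op: "openin (top_of_set ?U) (p ` S)" if "openin (top_of_set X) S" for S
    by (rule openin_proj_image[OF lin _ that]) (rule lift)
  obtain x0 where x0: "x0 \<in> X" "C = connected_component_set X x0"
    using C by (auto simp: components_def)
  obtain d where d: "d > 0" "\<And>x u. x \<in> X \<Longrightarrow> u \<in> ?U \<Longrightarrow> norm u < d \<Longrightarrow>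
      (\<exists>y\<in>X. p y = p x + u \<and> norm (y - x - u) < r / 4)"
    using lift[of "r/4"] r by auto
  have diffU: "a - b \<in> ?U" if "a \<in> ?U" "b \<in> ?U" for a b
    using sub that by (simp add: subspace_diff)
  \<comment> \<open>The image is nonempty and open in a connected base; it is also closed because
    the lifting radius \<open>d\<close> does not depend on the point.\<close>
  have surj: "p ` X = ?U"
  proof -
    have conn: "connected ?U" using sub convex_connected subspace_imp_convex by blast
    have o: "openin (top_of_set ?U) (p ` X)" by (rule op) auto
    have "openin (top_of_set ?U) (?U - p ` X)"
      unfolding openin_euclidean_subtopology_iff
    proof (intro conjI ballI)
      fix w assume w: "w \<in> ?U - p ` X"
      have "w' \<notin> p ` X" if w': "w' \<in> ?U" "dist w' w < d" for w'
      proof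
        assume "w' \<in> p ` X"
        then obtain x where x: "x \<in> X" "w' = p x" by auto
        obtain y where "y \<in> X" "p y = p x + (w - w')"
          using d(2)[OF x(1) diffU[of w w']] w w' by (auto simp: dist_norm norm_minus_commute)
        then show False using x w by auto
      qed
      then show "\<exists>e>0. \<forall>x'\<in>?U. dist x' w < e \<longrightarrow> x' \<in> ?U - p ` X" using d by auto
    qed auto
    then have c: "closedin (top_of_set ?U) (p ` X)"
      by (auto simp: closedin_def)
    from conn o c x0 show ?thesis
      unfolding connected_clopen by blast
  qed
  have cov: "covering_space X p ?U"
  proof (rule covering_spaceI[OF contp surj])
    fix w assume w: "w \<in> ?U"
    define T where "T = ?U \<inter> ball w d"
    \<comment> \<open>The sheet near \<open>x\<close>: points over \<open>T\<close> whose
      displacement from \<open>x\<close> has a component in the kernel of \<open>p\<close> shorter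
      than \<open>r/4\<close>.\<close>
    define W where "W x = {y \<in> X. p y \<in> T \<and> norm (y - x - p (y - x)) < r/4}" for x
    define F where "F = {x \<in> X. p x = w}"
    have oT: "openin (top_of_set ?U) T" by (auto simp: T_def openin_open)
    have wT: "w \<in> T" using w d by (auto simp: T_def)
    have oW: "openin (top_of_set X) (W x)" for x
    proof -
      have "openin (top_of_set X) (X \<inter> p -` ball w d)"
        "openin (top_of_set X) (X \<inter> (\<lambda>y. norm (y - x - p (y - x))) -` {..<r/4})"
        by (intro continuous_openin_preimage_gen continuous_intros contp
              continuous_on_compose2[OF contp[of UNIV]] open_ball open_lessThan; auto)+
      from openin_Int[OF this] show ?thesis
        by (rule back_subst) (auto simp: W_def T_def)
    qed
    \<comment> \<open>Points of one fibre differ by the difference of their kernel components, at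
      most \<open>r/2\<close> and so below the separation. The same estimate at the base points
      makes distinct sheets disjoint.\<close>
    have same: "y = z" if "x \<in> X" "y \<in> W x" "z \<in> W x" "p y = p z" for x y z
    proof (rule ccontr)
      assume "y \<noteq> z"
      then have "r \<le> norm (y - z)" using sep that by (auto simp: W_def)
      also have "y - z = (y - x - p (y - x)) - (z - x - p (z - x))"
        using that by (simp add: linear_diff[OF lin])
      also have "norm \<dots> \<le> r/4 + r/4"
        using that norm_triangle_ineq4[of "y - x - p (y - x)" "z - x - p (z - x)"]
        by (auto simp: W_def)
      finally show False using r by simp
    qed
    have dis: "x = x'" if "x \<in> F" "x' \<in> F" "y \<in> W x" "y \<in> W x'" for x x' y
    proof (rule ccontr)
      assume "x \<noteq> x'"
      then have "r \<le> norm (x - x')" using sep that by (auto simp: F_def)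
      also have "x - x' = (y - x' - p (y - x')) - (y - x - p (y - x))"
        using that by (simp add: linear_diff[OF lin] F_def)
      also have "norm \<dots> \<le> r/4 + r/4"
        using that norm_triangle_ineq4[of "y - x' - p (y - x')" "y - x - p (y - x)"]
        by (auto simp: W_def)
      finally show False using r by simp
    qed
    \<comment> \<open>Lifting the displacement \<open>w - p y\<close> from \<open>y\<close> reaches
      the point over \<open>w\<close> whose sheet contains \<open>y\<close>.\<close>
    have un: "\<Union>(W ` F) = X \<inter> p -` T"
    proof (intro equalityI subsetI)
      fix y assume y: "y \<in> X \<inter> p -` T"
      obtain x where x: "x \<in> X" "p x = p y + (w - p y)" "norm (x - y - (w - p y)) < r/4"
        using d(2)[of y "w - p y"] y diffU[of w "p y"] w by (auto simp: T_def dist_norm)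
      have "y - x - p (y - x) = - (x - y - (w - p y))"
        using x by (simp add: linear_diff[OF lin])
      then have "norm (y - x - p (y - x)) < r/4" using x by (metis norm_minus_cancel)
      then show "y \<in> \<Union>(W ` F)" using x y by (auto simp: W_def F_def)
    qed (auto simp: W_def)
    have img: "p ` W x = T" if xF: "x \<in> F" for x
    proof (intro equalityI subsetI)
      fix u assume u: "u \<in> T"
      obtain y where y: "y \<in> X" "p y = p x + (u - w)" "norm (y - x - (u - w)) < r/4"
        using d(2)[of x "u - w"] xF diffU[of u w] w u
        unfolding T_def F_def ball_def by (auto simp: dist_norm norm_minus_commute[of w u])
      have pyx: "p (y - x) = u - w" "p y = u"
        using y xF by (simp_all add: linear_diff[OF lin] F_def)
      have "y \<in> W x" unfolding W_def mem_Collect_eq pyx using y u by auto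
      then show "u \<in> p ` W x" using pyx by blast
    qed (auto simp: W_def)
    \<comment> \<open>On a sheet \<open>p\<close> is injective by \<open>same\<close> and open by
      \<open>op\<close>.\<close>
    have hom: "\<exists>q. homeomorphism (W x) T p q" if x: "x \<in> F" for x
    proof -
      have "openin (top_of_set T) (p ` S)" if "openin (top_of_set (W x)) S" for S
      proof (rule openin_subset_trans)
        show "openin (top_of_set ?U) (p ` S)"
          by (rule op, rule openin_trans[OF that oW])
        show "p ` S \<subseteq> T" using img[OF x] openin_imp_subset[OF that] by auto
      qed (auto simp: T_def)
      then show ?thesis
        using homeomorphism_injective_open_map[OF contp img[OF x]] same x
        by (metis (mono_tags, lifting) F_def inj_onI mem_Collect_eq)
    qed
    show "\<exists>T. w \<in> T \<and> openin (top_of_set ?U) T \<and>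
        (\<exists>v. \<Union>v = X \<inter> p -` T \<and> (\<forall>u\<in>v. openin (top_of_set X) u) \<and>
          pairwise disjnt v \<and> (\<forall>u\<in>v. \<exists>q. homeomorphism u T p q))"
    proof (intro exI[of _ T] exI[of _ "W ` F"] conjI)
      show "pairwise disjnt (W ` F)"
        using dis by (auto simp: pairwise_def disjnt_def)
    qed (use wT oT un oW hom in auto)
  qed
  \<comment> \<open>A section is a lift of the identity of the base through the covering.\<close>
  obtain s where s: "continuous_on ?U s" "s \<in> ?U \<rightarrow> X" "s (p x0) = x0" "\<And>y. y \<in> ?U \<Longrightarrow> p (s y) = y"
  proof (rule covering_space_lift_strong[OF cov x0(1), of "p x0" ?U id])
    show "simply_connected ?U"
      using sub subspace_imp_convex convex_imp_simply_connected by blast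
    show "locally path_connected ?U"
      using sub subspace_imp_convex convex_imp_locally_path_connected by blast
    show "id (p x0) = p x0" by simp
  qed auto
  have sX: "s ` ?U \<subseteq> X" using s(2) by auto
  have "s ` ?U = C"
  proof
    show "s ` ?U \<subseteq> C"
      unfolding x0(2)
    proof (rule connected_component_maximal)
      show "connected (s ` ?U)"
        by (rule connected_continuous_image[OF s(1) convex_connected[OF subspace_imp_convex[OF sub]]])
      show "x0 \<in> s ` ?U" using s(3) by (metis imageI rangeI)
    qed (rule sX)
    \<comment> \<open>The image of the section is the set where \<open>s (p x) = x\<close>, a closed
      condition.\<close>
    have cl: "closedin (top_of_set X) (s ` ?U)"
    proof -
      have "closedin (top_of_set X) {x \<in> X. s (p x) - x = 0}"
        using s(1) by (intro continuous_closedin_preimage_constant continuous_intros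
            continuous_on_compose2[OF s(1) contp]) auto
      also have "{x \<in> X. s (p x) - x = 0} = s ` ?U"
      proof (intro equalityI subsetI)
        fix x assume "x \<in> {x \<in> X. s (p x) - x = 0}"
        then have "s (p x) = x" by simp
        then show "x \<in> s ` ?U" by (metis imageI rangeI)
      next
        fix x assume "x \<in> s ` ?U"
        then show "x \<in> {x \<in> X. s (p x) - x = 0}" using s sX by auto
      qed
      finally show ?thesis .
    qed
    \<comment> \<open>\<open>s (p x)\<close> and \<open>x\<close> share a fibre, so a distance below
      \<open>r\<close> already forces equality; the condition is also open.\<close>
    have opn: "openin (top_of_set X) (s ` ?U)"
    proof -
      have "openin (top_of_set X) (X \<inter> (\<lambda>x. norm (s (p x) - x)) -` {..<r})"
        using s(1) by (intro continuous_openin_preimage_gen continuous_intros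
            continuous_on_compose2[OF s(1) contp]) auto
      also have "X \<inter> (\<lambda>x. norm (s (p x) - x)) -` {..<r} = s ` ?U"
      proof (intro equalityI subsetI)
        fix x assume "x \<in> X \<inter> (\<lambda>x. norm (s (p x) - x)) -` {..<r}"
        then have "s (p x) = x" using sep[of "s (p x)" x] s sX by force
        then show "x \<in> s ` ?U" by (metis imageI rangeI)
      next
        fix x assume "x \<in> s ` ?U"
        then show "x \<in> X \<inter> (\<lambda>x. norm (s (p x) - x)) -` {..<r}" using s sX r by auto
      qed
      finally show ?thesis .
    qed
    show "C \<subseteq> s ` ?U"
    proof -
      have CX: "C \<subseteq> X" and cC: "connected C"
        using C in_components_subset in_components_connected by auto
      obtain A where A: "open A" "s ` ?U = X \<inter> A" using opn unfolding openin_open by blast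
      obtain B where B: "closed B" "s ` ?U = X \<inter> B" using cl unfolding closedin_closed by blast
      have "C \<inter> s ` ?U = C \<inter> A" "C \<inter> s ` ?U = C \<inter> B" using A(2) B(2) CX by blast+
      then have "openin (top_of_set C) (C \<inter> s ` ?U)" "closedin (top_of_set C) (C \<inter> s ` ?U)"
        using A(1) B(1) unfolding openin_open closedin_closed by blast+
      moreover have "x0 \<in> C \<inter> s ` ?U"
        using x0 s(3) by (metis IntI connected_component_refl imageI mem_Collect_eq rangeI)
      ultimately show ?thesis using cC unfolding connected_clopen by blast
    qed
  qed
  then have "homeomorphism ?U C s p"
    unfolding homeomorphism_def using s(1,4) contp[of C] by (auto simp: image_image)
  then show ?thesis by blast
qed

subsection \<open>The torus and the closure of the point set\<close>

lemma rho_in_torus: "rho x \<in> torus"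
proof -
  have "exp (2 * of_real pi * \<i> * complex_of_real t) = exp (\<i> * of_real (2 * pi * t))" for t
    by (simp add: mult_ac)
  then show ?thesis by (simp add: rho_def torus_def)
qed

lemma rho_add: "rho (x + y) = rho x * rho y"
  by (simp add: rho_def vec_eq_iff exp_add[symmetric] algebra_simps)

lemma rho_0: "rho 0 = 1"
  by (simp add: rho_def vec_eq_iff)

lemma continuous_on_rho: "continuous_on A rho"
  unfolding rho_def by (intro continuous_intros)

lemma dist_mult_torus:
  assumes "c \<in> torus"
  shows "dist (a * c) (b * c) = dist a b"
  using assms by (simp add: dist_norm norm_vec_def torus_def norm_mult flip: left_diff_distrib)

lemma compact_torus: "compact (torus :: (complex ^ 'm::finite) set)"
proof (rule compact_eq_bounded_closed[THEN iffD2], intro conjI)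
  show "bounded (torus :: (complex ^ 'm) set)"
  proof (rule boundedI)
    fix z :: "complex ^ 'm" assume "z \<in> torus"
    then show "norm z \<le> real CARD('m)"
      using L2_set_le_sum_abs[of "\<lambda>i. cmod (z $ i)" UNIV] by (simp add: norm_vec_def torus_def)
  qed
  have "closed (\<Inter>i. {z :: complex ^ 'm. cmod (z $ i) = 1})"
    by (intro closed_INT ballI closed_Collect_eq continuous_intros)
  then show "closed (torus :: (complex ^ 'm) set)"
    by (simp add: torus_def Collect_all_eq)
qed

text \<open>Moving \<open>M\<close> across the inner product shows that a character with frequency
  in \<open>M^T\<close> applied to the integer lattice is a Laurent monomial in the torus
  coordinates of \<open>rho (M *v x)\<close>.\<close>

lemma character_transpose:
  fixes M :: "real ^ 'n::finite ^ 'm::finite"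
  assumes "\<And>i. k $ i = of_int (j i)"
  shows "character (transpose M *v k) x = (\<Prod>i\<in>UNIV. rho (M *v x) $ i powi j i)"
proof -
  have "(transpose M *v k) \<bullet> x = k \<bullet> (M *v x)"
    by (simp add: dot_lmul_matrix flip: vector_transpose_matrix)
  also have "\<dots> = (\<Sum>i\<in>UNIV. of_int (j i) * (M *v x) $ i)"
    by (simp add: inner_vec_def assms)
  finally have "character (transpose M *v k) x
      = exp (\<Sum>i\<in>UNIV. of_int (j i) * (2 * of_real pi * \<i> * of_real ((M *v x) $ i)))"
    by (simp add: character_def sum_distrib_left mult_ac)
  also have "\<dots> = (\<Prod>i\<in>UNIV. exp (2 * of_real pi * \<i> * of_real ((M *v x) $ i)) powi j i)"
    by (simp only: exp_sum finite exp_power_int)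
  finally show ?thesis by (simp add: rho_def)
qed

lemma bohr_ap_uniform_wrt_rho:
  fixes M :: "real ^ 'n::finite ^ 'm::finite"
  assumes F: "F \<in> bohr_ap_functions"
    and freq: "\<And>y. \<not> has_mean (\<lambda>t. F t * character (- y) t) 0 \<Longrightarrow>
                 y \<in> {transpose M *v k | k. \<forall>i. k $ i \<in> \<int>}"
    and e: "e > 0"
  shows "\<exists>d>0. \<forall>x x'. dist (rho (M *v x)) (rho (M *v x')) < d \<longrightarrow> cmod (F x - F x') < e"
proof -
  obtain D c where D: "finite D" "\<And>y. y \<in> D \<Longrightarrow> \<not> has_mean (\<lambda>t. F t * character (- y) t) 0"
    "\<And>x. cmod (F x - (\<Sum>y\<in>D. c y * character y x)) \<le> e/4"
    using bohr_approximation[OF F, of "e/4"] e by auto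
  have "\<forall>y\<in>D. \<exists>j. \<forall>x. character y x = (\<Prod>i\<in>UNIV. rho (M *v x) $ i powi j i)"
  proof
    fix y assume "y \<in> D"
    then obtain k where k: "y = transpose M *v k" "\<forall>i. k $ i \<in> \<int>" using freq D(2) by blast
    have "\<forall>i. \<exists>m. k $ i = of_int m" using k(2) by (auto simp: Ints_def)
    then obtain j where "\<forall>i. k $ i = of_int (j i)" by (rule choice[THEN exE])
    then have "character y x = (\<Prod>i\<in>UNIV. rho (M *v x) $ i powi j i)" for x
      unfolding k(1) by (intro character_transpose) blast
    then show "\<exists>j. \<forall>x. character y x = (\<Prod>i\<in>UNIV. rho (M *v x) $ i powi j i)" by blast
  qed
  then obtain j where "\<forall>y\<in>D. \<forall>x. character y x = (\<Prod>i\<in>UNIV. rho (M *v x) $ i powi j y i)"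
    by (rule bchoice[THEN exE])
  then have j: "character y x = (\<Prod>i\<in>UNIV. rho (M *v x) $ i powi j y i)" if "y \<in> D" for x y
    using that by blast
  define Q where "Q z = (\<Sum>y\<in>D. c y * (\<Prod>i\<in>UNIV. (z $ i) powi j y i))" for z :: "complex ^ 'm"
  \<comment> \<open>Exponents may be negative, so continuity of \<open>Q\<close> needs nonvanishing
    coordinates.\<close>
  have nz: "z $ i \<noteq> 0" if "z \<in> torus" for z :: "complex ^ 'm" and i
  proof -
    have "cmod (z $ i) = 1" using that by (simp add: torus_def)
    then show ?thesis by auto
  qed
  have "continuous_on torus Q"
    unfolding Q_def by (intro continuous_intros) (use nz in auto)
  then have "uniformly_continuous_on torus Q"
    by (rule compact_uniformly_continuous[OF _ compact_torus])
  moreover have "e/4 > 0" using e by simp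
  ultimately obtain d where d: "d > 0" "\<And>z z'. z \<in> torus \<Longrightarrow> z' \<in> torus \<Longrightarrow> dist z' z < d \<Longrightarrow> dist (Q z') (Q z) < e/4"
    unfolding uniformly_continuous_on_def by meson
  have approx: "cmod (F x - Q (rho (M *v x))) \<le> e/4" for x
    using D(3)[of x] j by (simp add: Q_def)
  have "cmod (F x - F x') < e" if "dist (rho (M *v x)) (rho (M *v x')) < d" for x x'
  proof -
    let ?q = "Q (rho (M *v x))" and ?q' = "Q (rho (M *v x'))"
    have "cmod (?q - ?q') < e/4" using d(2)[OF rho_in_torus rho_in_torus that] by (simp add: dist_norm)
    moreover have "F x - F x' = (F x - ?q) + (?q - ?q') - (F x' - ?q')" by simp
    ultimately show ?thesis
      using approx[of x] approx[of x'] e norm_triangle_ineq4[of "(F x - ?q) + (?q - ?q')" "F x' - ?q'"]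
        norm_triangle_ineq[of "F x - ?q" "?q - ?q'"] by simp
  qed
  then show ?thesis using d(1) by blast
qed

section \<open>Tent functions and the closure of the point set\<close>

definition tent :: "real \<Rightarrow> real ^ 'n::finite \<Rightarrow> complex" where
  "tent e x = of_real (max 0 (1 - norm x / e))"

lemma tent_0 [simp]: "tent e 0 = 1"
  by (simp add: tent_def)

lemma tent_eq_0: "e > 0 \<Longrightarrow> e \<le> norm x \<Longrightarrow> tent e x = 0"
  by (simp add: tent_def)

lemma continuous_on_tent: "continuous_on A (tent e)"
  \<comment> \<open>For \<open>e = 0\<close> division by zero makes the function constant.\<close>
  unfolding tent_def by (cases "e = 0") (auto intro!: continuous_intros)

lemma tent_in_Cc:
  assumes "e > 0"
  shows "(tent e :: real ^ 'n::finite \<Rightarrow> complex) \<in> Cc"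
proof -
  let ?S = "{x :: real ^ 'n. tent e x \<noteq> 0}"
  have "?S \<subseteq> cball 0 e"
  proof
    fix x assume "x \<in> ?S"
    then have "\<not> e \<le> norm x" using tent_eq_0[OF assms] by blast
    then show "x \<in> cball 0 e" by simp
  qed
  then have "closure ?S \<subseteq> cball 0 e"
    by (rule closure_minimal) simp
  then have "bounded (closure ?S)"
    using bounded_cball bounded_subset by blast
  then show ?thesis
    using continuous_on_tent by (simp add: Cc_def compact_eq_bounded_closed)
qed

lemma mu_conv_tent_eq_0:
  assumes "e > 0" "\<And>l. l \<in> \<Lambda> \<Longrightarrow> e \<le> norm (x - l)"
  shows "mu_conv \<Lambda> (tent e) x = 0"
  unfolding mu_conv_def using assms by (intro infsum_0 tent_eq_0)

text \<open>All other tents vanish at \<open>l\<close>. Against the value zero at distance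
  \<open>e\<close> from the set, this makes the convolution a detector of points that any
  oscillation below one cannot confuse.\<close>

lemma mu_conv_tent_eq_1:
  assumes "e > 0" "l \<in> \<Lambda>" "\<And>l'. l' \<in> \<Lambda> \<Longrightarrow> l' \<noteq> l \<Longrightarrow> e \<le> norm (l - l')"
  shows "mu_conv \<Lambda> (tent e) l = 1"
proof -
  have "mu_conv \<Lambda> (tent e) l = (\<Sum>\<^sub>\<infinity>l'\<in>{l}. tent e (l - l'))"
    unfolding mu_conv_def
  proof (rule infsum_cong_neutral)
    fix l' assume "l' \<in> \<Lambda> - {l}"
    then show "tent e (l - l') = 0" using assms by (intro tent_eq_0) auto
  qed (use assms in auto)
  then show ?thesis by simp
qed

text \<open>Otherwise points \<open>l\<close> and \<open>l'\<close> of the set approximate the two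
  ends of a short orbit piece, and \<open>l + t\<close> is close to \<open>l'\<close> in the torus
  metric. But the detector is one at \<open>l'\<close> and zero at \<open>l + t\<close>, since
  \<open>l + t\<close> keeps distance \<open>e\<close> from the whole set.\<close>

lemma closure_image_separated:
  fixes \<psi> :: "real ^ 'n::finite \<Rightarrow> complex ^ 'm::finite"
  assumes r: "r > 0" and sep: "\<And>a b. a \<in> \<Lambda> \<Longrightarrow> b \<in> \<Lambda> \<Longrightarrow> a \<noteq> b \<Longrightarrow> r \<le> norm (a - b)"
    and hom: "\<And>x y. \<psi> (x + y) = \<psi> x * \<psi> y" and tor: "\<And>x. \<psi> x \<in> torus"
    and unif: "\<And>e. e > 0 \<Longrightarrow> \<exists>d>0. \<forall>x x'. dist (\<psi> x) (\<psi> x') < d \<longrightarrow>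
       cmod (mu_conv \<Lambda> (tent e) x - mu_conv \<Lambda> (tent e) x') < 1"
    and p: "p \<in> closure (\<psi> ` \<Lambda>)" "p * \<psi> t \<in> closure (\<psi> ` \<Lambda>)" and t: "t \<noteq> 0"
  shows "r \<le> norm t"
proof (rule ccontr)
  assume "\<not> r \<le> norm t"
  then have tr: "norm t < r" by simp
  \<comment> \<open>\<open>l + t\<close> has distance \<open>norm t\<close> from \<open>l\<close>
    and at least \<open>r - norm t\<close> from every other point.\<close>
  define e where "e = min (norm t) (r - norm t)"
  have e: "e > 0" "e \<le> norm t" "e \<le> r - norm t" using t tr by (auto simp: e_def)
  obtain d where d: "d > 0" "\<And>x x'. dist (\<psi> x) (\<psi> x') < d \<Longrightarrow>
       cmod (mu_conv \<Lambda> (tent e) x - mu_conv \<Lambda> (tent e) x') < 1"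
    using unif[OF e(1)] by blast
  have d2: "d/2 > 0" using d by simp
  obtain l where l: "l \<in> \<Lambda>" "dist (\<psi> l) p < d/2"
    using p(1) d2 unfolding closure_approachable by blast
  obtain l' where l': "l' \<in> \<Lambda>" "dist (\<psi> l') (p * \<psi> t) < d/2"
    using p(2) d2 unfolding closure_approachable by blast
  have "dist (\<psi> (l + t)) (p * \<psi> t) < d/2"
    using l(2) tor by (simp add: hom dist_mult_torus)
  then have "dist (\<psi> (l + t)) (\<psi> l') < d"
    using l'(2) by (rule dist_triangle_half_l)
  then have "cmod (mu_conv \<Lambda> (tent e) (l + t) - mu_conv \<Lambda> (tent e) l') < 1"
    by (rule d(2))
  moreover have "mu_conv \<Lambda> (tent e) (l + t) = 0"
  proof (rule mu_conv_tent_eq_0[OF e(1)])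
    fix m assume m: "m \<in> \<Lambda>"
    show "e \<le> norm (l + t - m)"
    proof (cases "m = l")
      case False
      then have "r \<le> norm (l - m)" using sep m l by auto
      also have "l - m = (l + t - m) - t" by simp
      also have "norm \<dots> \<le> norm (l + t - m) + norm t" by (rule norm_triangle_ineq4)
      finally show ?thesis using e by simp
    qed (use e in simp)
  qed
  moreover have "mu_conv \<Lambda> (tent e) l' = 1"
  proof (rule mu_conv_tent_eq_1[OF e(1) l'(1)])
    fix m assume "m \<in> \<Lambda>" "m \<noteq> l'"
    then have "r \<le> norm (l' - m)" using sep l' by auto
    then show "e \<le> norm (l' - m)" using e norm_ge_zero[of t] by linarith
  qed
  ultimately show False by simp
qed

text \<open>When \<open>q\<close> is close to \<open>p\<close>, orbit points \<open>\<psi> x\<close>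
  near \<open>q\<close> have a nonzero detector value, so the set has a point \<open>m\<close>
  within \<open>e'\<close> of \<open>x\<close>. The times \<open>m - x\<close> lie in a compact
  ball; a limit \<open>t\<close> of them carries \<open>q\<close> into the closure.\<close>

lemma closure_image_transversal:
  fixes \<psi> :: "real ^ 'n::finite \<Rightarrow> complex ^ 'm::finite"
  assumes r: "r > 0" and sep: "\<And>a b. a \<in> \<Lambda> \<Longrightarrow> b \<in> \<Lambda> \<Longrightarrow> a \<noteq> b \<Longrightarrow> r \<le> norm (a - b)"
    and hom: "\<And>x y. \<psi> (x + y) = \<psi> x * \<psi> y" and cont: "continuous_on UNIV \<psi>"
    and dense: "torus \<subseteq> closure (range \<psi>)"
    and unif: "\<And>e. e > 0 \<Longrightarrow> \<exists>d>0. \<forall>x x'. dist (\<psi> x) (\<psi> x') < d \<longrightarrow>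
       cmod (mu_conv \<Lambda> (tent e) x - mu_conv \<Lambda> (tent e) x') < 1"
    and e: "e > 0"
  shows "\<exists>d>0. \<forall>p\<in>closure (\<psi> ` \<Lambda>). \<forall>q\<in>torus. dist q p < d \<longrightarrow>
      (\<exists>t. norm t < e \<and> q * \<psi> t \<in> closure (\<psi> ` \<Lambda>))"
proof -
  \<comment> \<open>\<open>e' \<le> r\<close> keeps the tents from overlapping at points of the set,
    and \<open>e' < e\<close> leaves room because limits are only known to lie in the closed
    ball.\<close>
  define e' where "e' = min (e/2) r"
  have e': "e' > 0" "e' < e" "e' \<le> r" using e r by (auto simp: e'_def)
  obtain d where d: "d > 0" "\<And>x x'. dist (\<psi> x) (\<psi> x') < d \<Longrightarrow>
       cmod (mu_conv \<Lambda> (tent e') x - mu_conv \<Lambda> (tent e') x') < 1"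
    using unif[OF e'(1)] by blast
  have "\<exists>t. norm t < e \<and> q * \<psi> t \<in> closure (\<psi> ` \<Lambda>)"
    if p: "p \<in> closure (\<psi> ` \<Lambda>)" and q: "q \<in> torus" and qp: "dist q p < d/3" for p q
  proof -
    have d3: "d/3 > 0" using d by simp
    obtain l where l: "l \<in> \<Lambda>" "dist (\<psi> l) p < d/3"
      using p d3 unfolding closure_approachable by blast
    have l1: "mu_conv \<Lambda> (tent e') l = 1"
    proof (rule mu_conv_tent_eq_1[OF e'(1) l(1)])
      fix m assume "m \<in> \<Lambda>" "m \<noteq> l"
      then have "r \<le> norm (l - m)" using sep l by auto
      then show "e' \<le> norm (l - m)" using e' by linarith
    qed
    \<comment> \<open>Three distances below \<open>d/3\<close> put \<open>\<psi> x\<close> within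
      \<open>d\<close> of \<open>\<psi> l\<close>, where the detector is one.\<close>
    have near: "\<exists>m\<in>\<Lambda>. norm (x - m) < e'" if x: "dist (\<psi> x) q < d/3" for x
    proof (rule ccontr)
      assume "\<not> ?thesis"
      then have "mu_conv \<Lambda> (tent e') x = 0"
        by (intro mu_conv_tent_eq_0[OF e'(1)]) (auto simp: not_less)
      moreover have "dist (\<psi> x) (\<psi> l) < d"
        using x qp l(2) dist_triangle[of "\<psi> x" "\<psi> l" q] dist_triangle[of q "\<psi> l" p]
        by (simp add: dist_commute)
      ultimately show False using d(2)[of x l] l1 by simp
    qed
    have "q \<in> closure (range \<psi>)" using q dense by blast
    then obtain z where z: "\<And>k. z k \<in> range \<psi>" "z \<longlonglongrightarrow> q"
      unfolding closure_sequential by blast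
    obtain N where N: "\<And>k. k \<ge> N \<Longrightarrow> dist (z k) q < d/3"
      using z(2) d3 unfolding lim_sequentially by blast
    have "\<forall>k. \<exists>x m. \<psi> x = z (k + N) \<and> m \<in> \<Lambda> \<and> norm (x - m) < e'"
    proof
      fix k
      obtain x where x: "z (k + N) = \<psi> x" using z(1) by blast
      then show "\<exists>x m. \<psi> x = z (k + N) \<and> m \<in> \<Lambda> \<and> norm (x - m) < e'"
        using near[of x] N[of "k + N"] by auto
    qed
    then obtain x m where xm: "\<And>k. \<psi> (x k) = z (k + N)" "\<And>k. m k \<in> \<Lambda>" "\<And>k. norm (x k - m k) < e'"
      by metis
    have "m k - x k \<in> cball 0 e'" for k using xm(3)[of k] by (simp add: norm_minus_commute)
    then have "\<exists>t\<in>cball 0 e'. \<exists>s::nat \<Rightarrow> nat. strict_mono s \<and> ((\<lambda>k. m k - x k) \<circ> s) \<longlonglongrightarrow> t"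
      by (rule compact_cball[unfolded compact_def, rule_format])
    then obtain t s where t: "t \<in> cball 0 e'" "strict_mono s" "((\<lambda>k. m k - x k) \<circ> s) \<longlonglongrightarrow> t"
      by blast
    have "(\<lambda>k. \<psi> (x (s k)) * \<psi> (m (s k) - x (s k))) \<longlonglongrightarrow> q * \<psi> t"
    proof -
      have "(\<lambda>k. z (k + N)) \<longlonglongrightarrow> q" using z(2) by (rule LIMSEQ_ignore_initial_segment)
      then have 1: "(\<lambda>k. \<psi> (x (s k))) \<longlonglongrightarrow> q"
        using LIMSEQ_subseq_LIMSEQ[OF _ t(2)] by (auto simp: xm(1) o_def)
      have "isCont \<psi> t" using cont by (simp add: continuous_on_eq_continuous_at)
      then have 2: "(\<lambda>k. \<psi> (m (s k) - x (s k))) \<longlonglongrightarrow> \<psi> t"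
        using isCont_tendsto_compose t(3) unfolding o_def by blast
      show ?thesis
        by (rule vec_tendstoI) (auto intro!: tendsto_mult tendsto_vec_nth 1 2)
    qed
    moreover have "\<psi> (x (s k)) * \<psi> (m (s k) - x (s k)) = \<psi> (m (s k))" for k
      by (simp flip: hom)
    ultimately have "(\<lambda>k. \<psi> (m (s k))) \<longlonglongrightarrow> q * \<psi> t" by simp
    then have "q * \<psi> t \<in> closure (\<psi> ` \<Lambda>)"
      using xm(2) unfolding closure_sequential by (intro exI[of _ "\<lambda>k. \<psi> (m (s k))"]) auto
    then show ?thesis using t(1) e' by (intro exI[of _ t]) auto
  qed
  then show ?thesis using d(1) by (intro exI[of _ "d/3"]) auto
qed

text \<open>The component of the full preimage through a point of \<open>H\<close> has a connected
  image, which must stay in \<open>K'\<close>. Hence components may be studied in the preimage of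
  all of \<open>K\<close>.\<close>

lemma component_preimage_of_component:
  assumes f: "continuous_on UNIV f" and "K' \<in> components K" and H: "H \<in> components (f -` K')"
  shows "H \<in> components (f -` K)"
proof -
  obtain x where x: "x \<in> f -` K'" "H = connected_component_set (f -` K') x"
    using H by (auto simp: components_def)
  have K': "K' \<subseteq> K" using assms(2) by (rule in_components_subset)
  let ?C = "connected_component_set (f -` K) x"
  have xC: "x \<in> ?C" using x(1) K' by (auto intro: connected_component_refl)
  have CK: "?C \<subseteq> f -` K" by (rule connected_component_subset)
  have "f ` ?C \<subseteq> K'"
  proof (rule components_maximal[OF assms(2)])
    show "connected (f ` ?C)"
      by (intro connected_continuous_image continuous_on_subset[OF f]) auto
    show "f ` ?C \<subseteq> K" using CK by auto
    show "K' \<inter> f ` ?C \<noteq> {}" using x(1) xC by blast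
  qed
  then have "?C \<subseteq> H"
    unfolding x(2) using xC by (intro connected_component_maximal) auto
  moreover have "H \<subseteq> ?C"
    unfolding x(2) by (intro connected_component_mono vimage_mono K')
  ultimately have "H = ?C" by blast
  then show ?thesis using x(1) K' by (auto simp: components_def)
qed

section \<open>Passage from the torus to its universal cover\<close>

theorem theorem3:
  fixes \<Lambda> :: "(real ^ 'n::finite) set"
    and M :: "real ^ 'n ^ 'm::finite"
    and \<psi> :: "real ^ 'n \<Rightarrow> complex ^ 'm"
    and K K\<^sub>c :: "(complex ^ 'm) set"
    and V U H\<^sub>c :: "(real ^ 'm) set"
  assumes "CARD('m) > CARD('n)"
    and "delone \<Lambda>"
    and "bohr_ap_set \<Lambda>"
    and "toral_type \<Lambda>"
    and "toral_compactification \<psi>"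
    and "\<psi> = rho \<circ> (\<lambda>x. M *v x)"
    and "associated \<Lambda> M"
    and "transpose M ** M = mat 1"
    and "K = closure (\<psi> ` \<Lambda>)"
    and "V = range (\<lambda>x. M *v x)"
    and "U = orthogonal_comp V"
    and "K\<^sub>c \<in> components K"
    and "H\<^sub>c \<in> components (rho -` K\<^sub>c)"
  shows "\<exists>h\<^sub>1 :: real ^ 'm \<Rightarrow> real ^ 'm.
           continuous_on U h\<^sub>1 \<and> h\<^sub>1 ` U \<subseteq> V \<and>
           (\<exists>g. homeomorphism U H\<^sub>c (\<lambda>u. h\<^sub>1 u + u) g)"
proof -
  define r where "r = R1 \<Lambda>"
  have r: "r > 0" using \<open>delone \<Lambda>\<close> by (simp add: delone_def r_def)
  have sep: "r \<le> norm (a - b)" if "a \<in> \<Lambda>" "b \<in> \<Lambda>" "a \<noteq> b" for a b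
    unfolding r_def using that by (rule R1_le_norm_diff)
  have \<psi>: "\<psi> x = rho (M *v x)" for x using assms(6) by simp
  have hom: "\<psi> (x + y) = \<psi> x * \<psi> y" for x y
    by (simp add: \<psi> matrix_vector_right_distrib rho_add)
  have tor: "\<psi> x \<in> torus" for x by (simp add: \<psi> rho_in_torus)
  have contpsi: "continuous_on UNIV \<psi>" and dense: "torus \<subseteq> closure (range \<psi>)"
    using assms(5) by (auto simp: toral_compactification_def)
  have unif: "\<exists>d>0. \<forall>x x'. dist (\<psi> x) (\<psi> x') < d \<longrightarrow>
       cmod (mu_conv \<Lambda> (tent e) x - mu_conv \<Lambda> (tent e) x') < 1" if e: "e > 0" for e
    unfolding \<psi>
  proof (rule bohr_ap_uniform_wrt_rho)
    show F: "mu_conv \<Lambda> (tent e) \<in> bohr_ap_functions"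
      using \<open>bohr_ap_set \<Lambda>\<close> tent_in_Cc[OF e] by (auto simp: bohr_ap_set_def)
    fix y assume n0: "\<not> has_mean (\<lambda>t. mu_conv \<Lambda> (tent e) t * character (- y) t) 0"
    obtain a where a: "has_mean (\<lambda>t. mu_conv \<Lambda> (tent e) t * character (- y) t) a"
      using bohr_ap_mean_exists[OF F] by blast
    \<comment> \<open>Almost periodicity supplies some mean \<open>a\<close>, and \<open>n0\<close>
      excludes the value zero.\<close>
    have "y \<in> spectrum \<Lambda>"
      using mean_nonzero_in_spectrum[OF r sep continuous_on_tent e tent_eq_0[OF e] a] n0 a by blast
    then show "y \<in> {transpose M *v k | k. \<forall>i. k $ i \<in> \<int>}"
      using \<open>associated \<Lambda> M\<close> unfolding associated_def by blast
  qed simp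
  \<comment> \<open>Keeps terms in the form \<open>transpose M *v x\<close>, in which
    \<open>MM\<close> and \<open>adj\<close> are stated.\<close>
  note transpose_matrix_vector [simp del]
  have MM: "transpose M *v (M *v x) = x" for x
    by (simp add: matrix_vector_mul_assoc assms(8))
  have adj: "(M *v x) \<bullet> w = x \<bullet> (transpose M *v w)" for x w
    by (metis dot_lmul_matrix vector_transpose_matrix)
  have normM: "norm (M *v x) = norm x" for x
    unfolding norm_eq_sqrt_inner adj MM ..
  \<comment> \<open>By \<open>M^T M = I\<close> the matrix \<open>M M^T\<close> is the orthogonal
    projection onto \<open>V\<close>, so \<open>\<pi>\<close> is the one onto
    \<open>U\<close>.\<close>
  define \<pi> where "\<pi> x = x - M *v (transpose M *v x)" for x
  have lin: "linear \<pi>"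
    unfolding \<pi>_def
    by (intro linear_compose_sub linear_ident linear_compose[OF matrix_vector_mul_linear matrix_vector_mul_linear, unfolded o_def])
  have tp: "transpose M *v \<pi> x = 0" for x
    by (simp add: \<pi>_def matrix_vector_mult_diff_distrib MM)
  have idem: "\<pi> (\<pi> x) = \<pi> x" for x
    by (subst (1) \<pi>_def) (simp add: tp)
  have piM: "\<pi> (M *v t) = 0" for t
    by (simp add: \<pi>_def MM)
  have U_iff: "x \<in> U \<longleftrightarrow> transpose M *v x = 0" for x
  proof -
    have "x \<in> U \<longleftrightarrow> (\<forall>t. t \<bullet> (transpose M *v x) = 0)"
      unfolding assms(10,11) orthogonal_comp_def orthogonal_def by (simp add: adj)
    also have "\<dots> \<longleftrightarrow> transpose M *v x = 0"
      by (auto dest: spec[of _ "transpose M *v x"])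
    finally show ?thesis .
  qed
  have U: "range \<pi> = U"
  proof (intro equalityI subsetI)
    fix x assume "x \<in> U"
    then have "x = \<pi> x" by (simp add: U_iff \<pi>_def)
    then show "x \<in> range \<pi>" by (rule range_eqI)
  qed (auto simp: U_iff tp)
  have "\<exists>s. homeomorphism (range \<pi>) H\<^sub>c s \<pi>"
  proof (rule component_graph_over_projection[OF lin idem r])
    show "H\<^sub>c \<in> components (rho -` K)"
      using component_preimage_of_component[OF continuous_on_rho assms(12,13)] .
    fix x y assume xy: "x \<in> rho -` K" "y \<in> rho -` K" "\<pi> x = \<pi> y" "x \<noteq> y"
    \<comment> \<open>Equal projections put \<open>y - x\<close> into \<open>V\<close>, so it is
      \<open>M\<close> applied to this time; as \<open>M\<close> is an isometry, separation in time
      is separation in space.\<close>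
    let ?t = "transpose M *v (y - x)"
    have y: "y - x = M *v ?t"
      using xy(3) by (simp add: \<pi>_def matrix_vector_mult_diff_distrib algebra_simps)
    have "rho y = rho x * \<psi> ?t"
      using y by (simp add: \<psi> flip: rho_add)
    then have "r \<le> norm ?t"
      using xy y by (intro closure_image_separated[OF r sep hom tor unif, of "rho x"])
        (auto simp: assms(9))
    then show "r \<le> norm (x - y)"
      using y normM[of ?t] by (simp add: norm_minus_commute)
  next
    fix e :: real assume e: "e > 0"
    obtain d where d: "d > 0" "\<And>p q. p \<in> K \<Longrightarrow> q \<in> torus \<Longrightarrow> dist q p < d \<Longrightarrow>
        \<exists>t. norm t < e \<and> q * \<psi> t \<in> K"
      using closure_image_transversal[OF r sep hom contpsi dense unif e] unfolding assms(9) by blast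
    \<comment> \<open>Continuity at zero suffices: multiplication by a torus element is an isometry,
      so \<open>d'\<close> serves all \<open>x\<close>.\<close>
    have "isCont (rho :: real ^ 'm \<Rightarrow> _) 0"
      using continuous_on_rho[of "UNIV :: (real ^ 'm) set"] by (simp add: continuous_on_eq_continuous_at)
    then obtain d' where d': "d' > 0" "\<And>u :: real ^ 'm. dist u 0 < d' \<Longrightarrow> dist (rho u) (rho 0) < d"
      using d(1) unfolding continuous_at_eps_delta by blast
    have "\<exists>y\<in>rho -` K. \<pi> y = \<pi> x + u \<and> norm (y - x - u) < e"
      if x: "x \<in> rho -` K" and u: "u \<in> range \<pi>" "norm u < d'" for x u
    proof -
      have "dist (rho (x + u)) (rho x) = dist (rho u * rho x) (rho 0 * rho x)"
        by (simp add: rho_add rho_0 mult.commute)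
      also have "\<dots> < d"
        using d'(2)[of u] u by (simp add: dist_mult_torus rho_in_torus)
      finally obtain t where t: "norm t < e" "rho (x + u) * \<psi> t \<in> K"
        using d(2)[of "rho x" "rho (x + u)"] x rho_in_torus by auto
      have "\<pi> (x + u + M *v t) = \<pi> x + u"
        using u idem by (auto simp: piM linear_add[OF lin])
      moreover have "rho (x + u + M *v t) \<in> K"
        using t by (simp add: \<psi> rho_add)
      ultimately show ?thesis
        using t normM[of t] by (intro bexI[of _ "x + u + M *v t"]) auto
    qed
    then show "\<exists>d>0. \<forall>x\<in>rho -` K. \<forall>u\<in>range \<pi>. norm u < d \<longrightarrow>
        (\<exists>y\<in>rho -` K. \<pi> y = \<pi> x + u \<and> norm (y - x - u) < e)"
      using d'(1) by blast
  qed
  then obtain s where s: "homeomorphism U H\<^sub>c s \<pi>" unfolding U by blast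
  \<comment> \<open>The map \<open>h\<^sub>1\<close> is the section minus the identity; its values
    are the \<open>V\<close>-components of the points \<open>s u\<close>.\<close>
  have "continuous_on U (\<lambda>u. s u - u)"
    using homeomorphism_cont1[OF s] by (intro continuous_intros)
  moreover have "(\<lambda>u. s u - u) ` U \<subseteq> V"
  proof
    fix v assume "v \<in> (\<lambda>u. s u - u) ` U"
    then obtain u where u: "u \<in> U" "v = s u - u" by blast
    have "\<pi> (s u) = u" using homeomorphism_apply1[OF s u(1)] .
    then have "s u = u + M *v (transpose M *v s u)" by (simp add: \<pi>_def diff_eq_eq)
    then have "v = M *v (transpose M *v s u)" using u(2) by (metis add_diff_cancel_left')
    then show "v \<in> V" unfolding assms(10) by blast
  qed
  moreover have "homeomorphism U H\<^sub>c (\<lambda>u. s u - u + u) \<pi>" using s by simp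
  ultimately show ?thesis by blast
qed

end
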